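(* Let $G=(V,E)$ be a locally finite connected graph, let $\Gamma$ be a closed nonunimodular subgroup of $\mathrm{Aut}(G)$ that acts transitively on $G$, and let $\mathbf{w}_\Gamma$ be the induced relative weight function, used to define the forests below. If $G$ is $\mathbf{w}_\Gamma$-amenable then, for every $\beta>0$, $\mathfrak{F}_\beta(G,\boldsymbol{U})=\mathfrak{W}_\beta(G,\boldsymbol{U})$ a.s., and $\mathrm{FMaxSF}(G,\boldsymbol{U})=\mathrm{WMaxSF}(G,\boldsymbol{U})$ a.s.
   Context: Relative weights: $\mathbf{w}_\Gamma^y(x):=|\Gamma_x y|/|\Gamma_y x|$ for $x,y\in V$, where $\Gamma_v=\{\gamma\in\Gamma:\gamma v=v\}$. Changing the reference point $y$ multiplies $\mathbf{w}_\Gamma^y(\cdot)$ by a positive constant, which does not affect the notions below; fix $o\in V$ and write $\mathbf{w}=\mathbf{w}_\Gamma^o$. $\Gamma$ is nonunimodular if its left Haar measure is not right-invariant (equivalently, here, $\mathbf{w}_\Gamma$ is not constant). $G$ is $\mathbf{w}_\Gamma$-amenable (weighted-amenable) if $\inf_F \mathbf{w}(\partial_VF)/\mathbf{w}(F)=0$, the infimum being over finite nonempty $F\subseteq V$, where $\mathbf{w}(A)=\sum_{v\in A}\mathbf{w}(v)$ and $\partial_VF$ is the vertex boundary of $F$ (the vertices outside $F$ adjacent to a vertex of $F$). Forests: $\boldsymbol{U}=(U_e)_{e\in E}$ are i.i.d. $\mathrm{Uniform}[0,1]$ labels. For an edge $e=(x,y)$ put $\mathbf{w}(e)=\min\{\mathbf{w}(x),\mathbf{w}(y)\}$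 and, for $\beta\in[0,\infty)$, $X_{e,\beta}=\mathbf{w}(e)^\beta(1-U_e)$. Define orders on $E$: $e\prec_{\mathbf{w}}e'$ iff $\mathbf{w}(e)<\mathbf{w}(e')$, or $\mathbf{w}(e)=\mathbf{w}(e')$ and $1-U_e<1-U_{e'}$; $e\prec_\beta e'$ iff $X_{e,\beta}<X_{e',\beta}$, or $X_{e,\beta}=X_{e',\beta}$ and $1-U_e<1-U_{e'}$. For each order, the free forest is obtained from $G$ by simultaneously deleting the least edge in every finite cycle, and the wired forest is obtained by additionally deleting every edge that is least on some bi-infinite simple path. The free and wired forests are denoted $\mathrm{FMaxSF}(G,\boldsymbol{U})$, $\mathrm{WMaxSF}(G,\boldsymbol{U})$ for $\prec_{\mathbf{w}}$, and $\mathfrak{F}_\beta(G,\boldsymbol{U})$, $\mathfrak{W}_\beta(G,\boldsymbol{U})$ for $\prec_\beta$. *)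

theory Defs
  imports "HOL-Probability.Probability" "HOL-Algebra.Bij" "HOL-Algebra.Coset"
begin

section \<open>Graphs and their automorphisms\<close>

text \<open>
  A graph is given by its edge set, a set of two-element sets of vertices; its vertex set is
  the whole type \<open>'v\<close>.
\<close>

definition simple_graph :: "'v set set \<Rightarrow> bool" where
  "simple_graph E \<longleftrightarrow> (\<forall>e\<in>E. card e = 2)"

definition locally_finite_graph :: "'v set set \<Rightarrow> bool" where
  "locally_finite_graph E \<longleftrightarrow> (\<forall>x. finite {y. {x, y} \<in> E})"

definition connected_graph :: "'v set set \<Rightarrow> bool" where
  "connected_graph E \<longleftrightarrow> (\<forall>x y. (x, y) \<in> {(u, v). {u, v} \<in> E}\<^sup>*)"

definition Aut_group :: "'v set set \<Rightarrow> ('v \<Rightarrow> 'v) monoid" where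
  "Aut_group E =
     (BijGroup UNIV)\<lparr>carrier := {f \<in> Bij UNIV. \<forall>x y. {f x, f y} \<in> E \<longleftrightarrow> {x, y} \<in> E}\<rparr>"

definition pointwise_topology :: "('v \<Rightarrow> 'v) set \<Rightarrow> ('v \<Rightarrow> 'v) topology" where
  "pointwise_topology \<Gamma> =
     subtopology (product_topology (\<lambda>_. discrete_topology UNIV) UNIV) \<Gamma>"

definition closed_subgroup_Aut :: "('v \<Rightarrow> 'v) set \<Rightarrow> 'v set set \<Rightarrow> bool" where
  "closed_subgroup_Aut \<Gamma> E \<longleftrightarrow>
     subgroup \<Gamma> (Aut_group E) \<and>
     closedin (pointwise_topology (carrier (Aut_group E))) \<Gamma>"

definition acts_transitively :: "('v \<Rightarrow> 'v) set \<Rightarrow> bool" where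
  "acts_transitively \<Gamma> \<longleftrightarrow> (\<forall>x y. \<exists>\<gamma>\<in>\<Gamma>. \<gamma> x = y)"


section \<open>Haar measure and unimodularity\<close>

text \<open>
  A left Haar measure on a locally compact group \<open>G\<close> with topology \<open>T\<close>: a nonzero
  left-invariant Radon measure on the Borel sets of \<open>T\<close>.
\<close>

definition left_haar_measure ::
  "('a, 'b) monoid_scheme \<Rightarrow> 'a topology \<Rightarrow> 'a measure \<Rightarrow> bool" where
  "left_haar_measure G T \<mu> \<longleftrightarrow>
     space \<mu> = topspace T \<and>
     sets \<mu> = sigma_sets (topspace T) {U. openin T U} \<and>
     emeasure \<mu> (space \<mu>) \<noteq> 0 \<and>
     (\<forall>K. compactin T K \<and> K \<in> sets \<mu> \<longrightarrow> emeasure \<mu> K < \<infinity>) \<and>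
     (\<forall>A\<in>sets \<mu>. emeasure \<mu> A = (INF U\<in>{U. openin T U \<and> A \<subseteq> U}. emeasure \<mu> U)) \<and>
     (\<forall>U. openin T U \<longrightarrow>
        emeasure \<mu> U = (SUP K\<in>{K. compactin T K \<and> K \<in> sets \<mu> \<and> K \<subseteq> U}. emeasure \<mu> K)) \<and>
     (\<forall>g\<in>carrier G. \<forall>A\<in>sets \<mu>. emeasure \<mu> (g <#\<^bsub>G\<^esub> A) = emeasure \<mu> A)"

definition right_invariant_measure :: "('a, 'b) monoid_scheme \<Rightarrow> 'a measure \<Rightarrow> bool" where
  "right_invariant_measure G \<mu> \<longleftrightarrow>
     (\<forall>g\<in>carrier G. \<forall>A\<in>sets \<mu>. emeasure \<mu> (A #>\<^bsub>G\<^esub> g) = emeasure \<mu> A)"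

text \<open>
  Left Haar measure is unique up to a positive factor, so it does not matter which one is
  tested for right invariance.
\<close>

definition nonunimodular :: "('v \<Rightarrow> 'v) set \<Rightarrow> 'v set set \<Rightarrow> bool" where
  "nonunimodular \<Gamma> E \<longleftrightarrow>
     (\<exists>\<mu>. left_haar_measure ((Aut_group E)\<lparr>carrier := \<Gamma>\<rparr>) (pointwise_topology \<Gamma>) \<mu> \<and>
          \<not> right_invariant_measure ((Aut_group E)\<lparr>carrier := \<Gamma>\<rparr>) \<mu>)"


section \<open>Relative weights and weighted amenability\<close>

definition vertex_stabilizer :: "('v \<Rightarrow> 'v) set \<Rightarrow> 'v \<Rightarrow> ('v \<Rightarrow> 'v) set" where
  "vertex_stabilizer \<Gamma> x = {\<gamma> \<in> \<Gamma>. \<gamma> x = x}"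

definition rel_weight :: "('v \<Rightarrow> 'v) set \<Rightarrow> 'v \<Rightarrow> 'v \<Rightarrow> real" where
  "rel_weight \<Gamma> y x =
     real (card ((\<lambda>\<gamma>. \<gamma> y) ` vertex_stabilizer \<Gamma> x)) /
     real (card ((\<lambda>\<gamma>. \<gamma> x) ` vertex_stabilizer \<Gamma> y))"

definition vertex_boundary :: "'v set set \<Rightarrow> 'v set \<Rightarrow> 'v set" where
  "vertex_boundary E F = {v. v \<notin> F \<and> (\<exists>u\<in>F. {u, v} \<in> E)}"

definition weighted_amenable :: "'v set set \<Rightarrow> ('v \<Rightarrow> real) \<Rightarrow> bool" where
  "weighted_amenable E w \<longleftrightarrow>
     (INF F\<in>{F. finite F \<and> F \<noteq> {}}. sum w (vertex_boundary E F) / sum w F) = 0"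


section \<open>Edge orders\<close>

text \<open>Throughout, \<open>u :: 'v set \<Rightarrow> real\<close> is one realization of the edge labels.\<close>

definition edge_weight :: "('v \<Rightarrow> real) \<Rightarrow> 'v set \<Rightarrow> real" where
  "edge_weight w e = Min (w ` e)"

definition edge_X :: "('v \<Rightarrow> real) \<Rightarrow> real \<Rightarrow> ('v set \<Rightarrow> real) \<Rightarrow> 'v set \<Rightarrow> real" where
  "edge_X w \<beta> u e = edge_weight w e powr \<beta> * (1 - u e)"

definition less_max :: "('v \<Rightarrow> real) \<Rightarrow> ('v set \<Rightarrow> real) \<Rightarrow> 'v set \<Rightarrow> 'v set \<Rightarrow> bool" where
  "less_max w u e e' \<longleftrightarrow>
     edge_weight w e < edge_weight w e' \<or>
     edge_weight w e = edge_weight w e' \<and> 1 - u e < 1 - u e'"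

definition less_beta ::
  "('v \<Rightarrow> real) \<Rightarrow> real \<Rightarrow> ('v set \<Rightarrow> real) \<Rightarrow> 'v set \<Rightarrow> 'v set \<Rightarrow> bool" where
  "less_beta w \<beta> u e e' \<longleftrightarrow>
     edge_X w \<beta> u e < edge_X w \<beta> u e' \<or>
     edge_X w \<beta> u e = edge_X w \<beta> u e' \<and> 1 - u e < 1 - u e'"


section \<open>Free and wired forests\<close>

definition least_edge :: "('v set \<Rightarrow> 'v set \<Rightarrow> bool) \<Rightarrow> 'v set \<Rightarrow> 'v set set \<Rightarrow> bool" where
  "least_edge R e C \<longleftrightarrow> e \<in> C \<and> (\<forall>e'\<in>C. e' \<noteq> e \<longrightarrow> R e e')"

definition cycle_edges :: "'v list \<Rightarrow> 'v set set" where
  "cycle_edges xs = {{xs ! i, xs ! (Suc i mod length xs)} |i. i < length xs}"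

definition finite_cycles :: "'v set set \<Rightarrow> 'v set set set" where
  "finite_cycles E =
     {cycle_edges xs |xs. 3 \<le> length xs \<and> distinct xs \<and> cycle_edges xs \<subseteq> E}"

definition biinf_path_edges :: "(int \<Rightarrow> 'v) \<Rightarrow> 'v set set" where
  "biinf_path_edges p = {{p i, p (i + 1)} |i. True}"

definition biinf_simple_paths :: "'v set set \<Rightarrow> 'v set set set" where
  "biinf_simple_paths E = {biinf_path_edges p |p. inj p \<and> biinf_path_edges p \<subseteq> E}"

definition free_forest :: "'v set set \<Rightarrow> ('v set \<Rightarrow> 'v set \<Rightarrow> bool) \<Rightarrow> 'v set set" where
  "free_forest E R = E - {e. \<exists>C\<in>finite_cycles E. least_edge R e C}"

definition wired_forest :: "'v set set \<Rightarrow> ('v set \<Rightarrow> 'v set \<Rightarrow> bool) \<Rightarrow> 'v set set" where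
  "wired_forest E R =
     free_forest E R - {e. \<exists>P\<in>biinf_simple_paths E. least_edge R e P}"

definition FMaxSF :: "'v set set \<Rightarrow> ('v \<Rightarrow> real) \<Rightarrow> ('v set \<Rightarrow> real) \<Rightarrow> 'v set set" where
  "FMaxSF E w u = free_forest E (less_max w u)"

definition WMaxSF :: "'v set set \<Rightarrow> ('v \<Rightarrow> real) \<Rightarrow> ('v set \<Rightarrow> real) \<Rightarrow> 'v set set" where
  "WMaxSF E w u = wired_forest E (less_max w u)"

definition F_beta ::
  "'v set set \<Rightarrow> ('v \<Rightarrow> real) \<Rightarrow> real \<Rightarrow> ('v set \<Rightarrow> real) \<Rightarrow> 'v set set" where
  "F_beta E w \<beta> u = free_forest E (less_beta w \<beta> u)"

definition W_beta ::
  "'v set set \<Rightarrow> ('v \<Rightarrow> real) \<Rightarrow> real \<Rightarrow> ('v set \<Rightarrow> real) \<Rightarrow> 'v set set" where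
  "W_beta E w \<beta> u = wired_forest E (less_beta w \<beta> u)"

definition (in prob_space) iid_uniform_labels ::
  "'e set \<Rightarrow> ('e \<Rightarrow> 'a \<Rightarrow> real) \<Rightarrow> bool" where
  "iid_uniform_labels E U \<longleftrightarrow>
     indep_vars (\<lambda>_. borel) U E \<and>
     (\<forall>e\<in>E. distr M borel (U e) = uniform_measure lborel {0..1})"

end

theory Submission
  imports Defs
begin

text \<open>
  Call an edge \<open>e\<close> of the free forest an excess edge if from each of its ends one can get
  infinitely far along edges above \<open>e\<close>.  An edge of the free forest that is least on a
  bi-infinite path is an excess edge, because the path without \<open>e\<close> consists of two rays of edges
  above \<open>e\<close>.  So it suffices that almost surely there are no excess edges, and this follows by
  comparing two estimates of the mass that they carry.

  Give each edge the score \<open>w(e) (1 - U\<^sub>e)\<^sup>\<alpha>\<close> with \<open>\<alpha> = 1/\<beta>\<close>, or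
  \<open>\<alpha> = 0\<close> for the order \<open>\<prec>\<close> that compares weights first.  Both kinds of order are then
  ``compare scores, break ties by \<open>1 - U\<^sub>e\<close>'', the score of an edge is at most the weight of each
  of its ends, and it is homogeneous of degree one in the weight.

  Upper bound, for every realization with distinct labels in \<open>[0,1)\<close>: the scores of the excess
  edges that meet a finite set \<open>K\<close> add up to at most \<open>w(\<partial>K)\<close>.  The clusters formed by the
  edges of the free forest that are above an excess edge \<open>e\<close> and are not excess edges themselves are
  infinite at both ends of \<open>e\<close> (\<open>infinite_cluster_above_escaping_edge\<close>), so from either end one can
  walk inside such a cluster to a vertex of \<open>\<partial>K\<close>, whose weight is at least the score of
  \<open>e\<close>.  If every tree of the free forest is rooted and the walk starts at the end of \<open>e\<close> that is
  farther from the root, then different edges lead to different vertices: contracting the clusters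
  turns the tree into a tree whose edges are the excess edges, and there a node determines the edge
  that leads towards the root (\<open>boundary_injection\<close>).

  Lower bound, in expectation: by the cocycle identity for relative weights an automorphism
  \<open>\<gamma>\<close> multiplies all weights by one constant, hence it preserves the order in law and multiplies
  the expected score by that constant.  If some edge \<open>e\<close> has positive expected excess score, then by
  transitivity every vertex \<open>v\<close> lies on an edge whose expected excess score is a fixed positive
  multiple of \<open>w(v)\<close>, so the expected mass of the excess edges that meet \<open>K\<close> is at least a constant
  times \<open>w(K)\<close>.  Weighted amenability makes \<open>w(\<partial>K)/w(K)\<close> arbitrarily small, which
  contradicts the upper bound.
\<close>

section \<open>Connectivity and cycles in the free forest\<close>

definition linked :: "'v set set \<Rightarrow> 'v \<Rightarrow> 'v \<Rightarrow> bool" where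
  "linked S x y \<longleftrightarrow> (x, y) \<in> {(u, v). {u, v} \<in> S}\<^sup>*"

lemma linked_refl [simp]: "linked S x x"
  by (simp add: linked_def)

lemma linked_step: "linked S x y \<Longrightarrow> {y, z} \<in> S \<Longrightarrow> linked S x z"
  unfolding linked_def by (rule rtrancl_into_rtrancl) auto

lemma linked_edge: "{x, y} \<in> S \<Longrightarrow> linked S x y"
  by (rule linked_step[OF linked_refl])

lemma linked_trans [trans]: "linked S x y \<Longrightarrow> linked S y z \<Longrightarrow> linked S x z"
  unfolding linked_def by (rule rtrancl_trans)

lemma linked_sym: "linked S x y \<Longrightarrow> linked S y x"
  unfolding linked_def
  by (rule symD[OF sym_rtrancl]) (auto simp: sym_def insert_commute)

lemma linked_induct [consumes 1, case_names refl step]: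
  assumes "linked S x y" "P x" "\<And>y z. linked S x y \<Longrightarrow> {y, z} \<in> S \<Longrightarrow> P y \<Longrightarrow> P z"
  shows "P y"
  using assms(1) unfolding linked_def
  by (induction rule: rtrancl_induct) (use assms(2,3) in \<open>auto simp: linked_def\<close>)

lemma linked_mono: "linked S x y \<Longrightarrow> S \<subseteq> T \<Longrightarrow> linked T x y"
  by (induction rule: linked_induct) (auto intro: linked_step)

lemma linked_insert:
  assumes "linked (insert {a, b} S) p q"
  shows "linked S p q \<or> linked S p a \<and> linked S b q \<or> linked S p b \<and> linked S a q"
  using assms
proof (induction rule: linked_induct)
  case (step y z)
  then show ?case
    by (auto simp: doubleton_eq_iff intro: linked_step)
qed auto

lemma linked_simple_path:
  assumes "linked S x y"
  shows "\<exists>xs. xs \<noteq> [] \<and> distinct xs \<and> hd xs = x \<and> last xs = y \<and>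
              (\<forall>i. Suc i < length xs \<longrightarrow> {xs ! i, xs ! Suc i} \<in> S)"
  using assms
proof (induction rule: linked_induct)
  case refl
  show ?case by (rule exI[of _ "[x]"]) simp
next
  case (step y z)
  then obtain xs where xs: "xs \<noteq> []" "distinct xs" "hd xs = x" "last xs = y"
    "\<And>i. Suc i < length xs \<Longrightarrow> {xs ! i, xs ! Suc i} \<in> S" by auto
  show ?case
  proof (cases "z \<in> set xs")
    case True
    then obtain k where k: "k < length xs" "xs ! k = z" by (auto simp: in_set_conv_nth)
    have "last (take (Suc k) xs) = z" using k by (simp add: take_Suc_conv_app_nth)
    then show ?thesis
      by (intro exI[of _ "take (Suc k) xs"]) (use xs k in \<open>auto simp: hd_take\<close>)
  next
    case False
    have "{(xs @ [z]) ! i, (xs @ [z]) ! Suc i} \<in> S" if "Suc i < length (xs @ [z])" for i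
    proof (cases "Suc i < length xs")
      case True
      then show ?thesis using xs(5) by (simp add: nth_append)
    next
      case F: False
      then have "i = length xs - 1" "Suc i = length xs" using that by auto
      then show ?thesis using xs(1,4) step.hyps by (simp add: nth_append last_conv_nth)
    qed
    then show ?thesis
      by (intro exI[of _ "xs @ [z]"]) (use xs False in auto)
  qed
qed

definition crosses :: "'v set \<Rightarrow> 'v set \<Rightarrow> bool" where
  "crosses A e \<longleftrightarrow> e \<inter> A \<noteq> {} \<and> \<not> e \<subseteq> A"

lemma crosses_pair: "crosses A {x, y} \<longleftrightarrow> (x \<in> A \<longleftrightarrow> y \<notin> A)"
  by (auto simp: crosses_def)

lemma sequence_crosses:
  fixes g :: "nat \<Rightarrow> 'v"
  assumes "m \<le> n" "g m \<in> A \<longleftrightarrow> g n \<notin> A"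
  shows "\<exists>k. m \<le> k \<and> k < n \<and> crosses A {g k, g (Suc k)}"
proof (rule ccontr)
  assume *: "\<not> ?thesis"
  have "m \<le> k \<Longrightarrow> k \<le> n \<Longrightarrow> g k \<in> A \<longleftrightarrow> g m \<in> A" for k
  proof (induction k rule: dec_induct)
    case (step k)
    then show ?case using * by (auto simp: crosses_pair)
  qed simp
  from this[of n] assms show False by auto
qed

text \<open>
  Going once around a cycle, the set is left as often as it is entered.
\<close>

lemma cycle_crosses_twice:
  assumes "3 \<le> length xs" "distinct xs" "f \<in> cycle_edges xs" "crosses A f"
  shows "\<exists>f'\<in>cycle_edges xs. f' \<noteq> f \<and> crosses A f'"
proof -
  let ?n = "length xs"
  from assms(3) obtain i where i: "i < ?n" "f = {xs ! i, xs ! (Suc i mod ?n)}"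
    by (auto simp: cycle_edges_def)
  have n0: "?n > 0" using assms(1) by auto
  define g where "g k = rotate i xs ! (k mod ?n)" for k
  have g: "g k = xs ! ((i + k) mod ?n)" for k
    using n0 by (simp add: g_def nth_rotate mod_add_right_eq)
  have g_inj: "g k = g l \<longleftrightarrow> k mod ?n = l mod ?n" for k l
    using assms(2) n0 by (simp add: g_def nth_eq_iff_index_eq)
  have f: "f = {g 0, g 1}" using i by (simp add: g)
  have gn: "g ?n = g 0" by (simp add: g_inj)
  have "\<exists>k. 1 \<le> k \<and> k < ?n \<and> crosses A {g k, g (Suc k)}"
    by (rule sequence_crosses) (use assms(1,4) in \<open>auto simp: gn f crosses_pair\<close>)
  then obtain k where k: "1 \<le> k" "k < ?n" "crosses A {g k, g (Suc k)}" by blast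
  have "{g k, g (Suc k)} \<in> cycle_edges xs"
    unfolding cycle_edges_def
    by (rule CollectI, rule exI[of _ "(i + k) mod ?n"]) (use n0 in \<open>auto simp: g mod_Suc_eq\<close>)
  moreover have "{g k, g (Suc k)} \<noteq> f"
  proof
    assume "{g k, g (Suc k)} = f"
    then have "g k = g 0 \<or> g k = g 1 \<and> g (Suc k) = g 0" by (auto simp: f doubleton_eq_iff)
    moreover have "g k \<noteq> g 0" using k by (simp add: g_inj)
    moreover have "g 2 \<noteq> g 0" if "g k = g 1"
      using assms(1) by (simp add: g_inj)
    moreover have "k = 1" if "g k = g 1"
      using that k assms(1) unfolding g_inj by simp
    ultimately show False by (auto simp: numeral_2_eq_2)
  qed
  ultimately show ?thesis using k(3) by (intro bexI[of _ "{g k, g (Suc k)}"] conjI)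
qed


section \<open>Escaping edges\<close>

text \<open>
  For each end of \<open>e\<close>, the cluster of that end in the graph of the edges above \<open>e\<close> is infinite.
  Infinity is expressed by cuts: every finite vertex set that contains an end of \<open>e\<close> is crossed by
  an edge above \<open>e\<close>.  In this form only countably many conditions are involved, so that the event
  is measurable, whereas there are uncountably many bi-infinite paths.
\<close>

definition escapes :: "'v set set \<Rightarrow> ('v set \<Rightarrow> 'v set \<Rightarrow> bool) \<Rightarrow> 'v set \<Rightarrow> bool" where
  "escapes E R e \<longleftrightarrow>
     (\<forall>A. finite A \<and> e \<inter> A \<noteq> {} \<longrightarrow> (\<exists>f\<in>E. crosses A f \<and> R e f))"

definition excess_edges :: "'v set set \<Rightarrow> ('v set \<Rightarrow> 'v set \<Rightarrow> bool) \<Rightarrow> 'v set set" where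
  "excess_edges E R = {e \<in> free_forest E R. escapes E R e}"

lemma inj_leaves_finite:
  assumes "inj (g :: nat \<Rightarrow> 'v)" "finite A"
  shows "\<exists>k. g k \<notin> A"
  using assms finite_imageD[of g UNIV] infinite_UNIV_nat finite_subset[of "range g" A] by blast

text \<open>
  Removing \<open>e\<close> splits the path into two rays, and each ray leaves every finite set through an edge
  above \<open>e\<close>.
\<close>

lemma least_on_path_escapes:
  fixes E :: "'v set set"
  assumes "P \<in> biinf_simple_paths E" "least_edge R e P"
  shows "escapes E R e"
  unfolding escapes_def
proof (intro allI impI, elim conjE)
  fix A assume A: "finite A" "e \<inter> A \<noteq> {}"
  from assms obtain p where p: "inj p" "P = biinf_path_edges p" "P \<subseteq> E"
    by (auto simp: biinf_simple_paths_def)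
  with assms(2) obtain i where i: "e = {p i, p (i + 1)}"
    by (auto simp: least_edge_def biinf_path_edges_def)
  have leave: "\<exists>f\<in>E. crosses A f \<and> R e f"
    if g: "inj g" "g 0 \<in> A" "\<And>k. {g k, g (Suc k)} \<in> P" "\<And>k. {g k, g (Suc k)} \<noteq> e"
    for g :: "nat \<Rightarrow> 'v"
  proof -
    obtain n where "g n \<notin> A" using inj_leaves_finite[OF g(1) A(1)] by blast
    with sequence_crosses[of 0 n g A] g(2) obtain k where "crosses A {g k, g (Suc k)}" by auto
    moreover have "R e {g k, g (Suc k)}" using assms(2) g(3,4) by (auto simp: least_edge_def)
    ultimately show ?thesis using g(3) p(3) by blast
  qed
  from A(2) i consider "p i \<in> A" | "p (i + 1) \<in> A" by auto
  then show "\<exists>f\<in>E. crosses A f \<and> R e f"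
  proof cases
    case 1
    show ?thesis
    proof (rule leave[of "\<lambda>k. p (i - int k)"])
      fix k
      have "{p (i - int k), p (i - int (Suc k))} = {p (i - int (Suc k)), p (i - int (Suc k) + 1)}"
        by (auto simp: insert_commute)
      then show "{p (i - int k), p (i - int (Suc k))} \<in> P"
        unfolding p biinf_path_edges_def by blast
      show "{p (i - int k), p (i - int (Suc k))} \<noteq> e"
        using p(1) by (auto simp: i doubleton_eq_iff inj_eq)
    qed (use 1 in \<open>auto simp: inj_on_def dest: injD[OF p(1)]\<close>)
  next
    case 2
    show ?thesis
    proof (rule leave[of "\<lambda>k. p (i + 1 + int k)"])
      fix k
      have "{p (i + 1 + int k), p (i + 1 + int (Suc k))} = {p (i + 1 + int k), p (i + 1 + int k + 1)}"
        by (simp add: algebra_simps)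
      then show "{p (i + 1 + int k), p (i + 1 + int (Suc k))} \<in> P"
        unfolding p biinf_path_edges_def by blast
      show "{p (i + 1 + int k), p (i + 1 + int (Suc k))} \<noteq> e"
        using p(1) by (auto simp: i doubleton_eq_iff inj_eq)
    qed (use 2 in \<open>auto simp: inj_on_def dest: injD[OF p(1)]\<close>)
  qed
qed

lemma free_minus_wired_subset_excess:
  "free_forest E R - wired_forest E R \<subseteq> excess_edges E R"
  by (auto simp: wired_forest_def excess_edges_def dest: least_on_path_escapes)

lemma edge_ends:
  assumes "simple_graph E" "e \<in> E" obtains x y where "e = {x, y}"
  using assms by (auto simp: simple_graph_def card_2_iff)

lemma finite_incident:
  assumes "simple_graph E" "locally_finite_graph E" "finite A"
  shows "finite {e \<in> E. e \<inter> A \<noteq> {}}"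
proof -
  have "{e \<in> E. e \<inter> A \<noteq> {}} \<subseteq> (\<Union>x\<in>A. (\<lambda>y. {x, y}) ` {y. {x, y} \<in> E})"
  proof
    fix e assume "e \<in> {e \<in> E. e \<inter> A \<noteq> {}}"
    then have "e \<in> E" and "e \<inter> A \<noteq> {}" by auto
    from \<open>e \<in> E\<close> obtain x y where "e = {x, y}" by (rule edge_ends[OF assms(1)])
    then have "e = {x, y}" "e = {y, x}" by auto
    then have "\<exists>x y. e = {x, y} \<and> x \<in> A" using \<open>e \<inter> A \<noteq> {}\<close> by blast
    then show "e \<in> (\<Union>x\<in>A. (\<lambda>y. {x, y}) ` {y. {x, y} \<in> E})"
      using \<open>e \<in> E\<close> by auto
  qed
  moreover have "finite (\<Union>x\<in>A. (\<lambda>y. {x, y}) ` {y. {x, y} \<in> E})"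
    using assms(2,3) by (auto simp: locally_finite_graph_def)
  ultimately show ?thesis by (rule finite_subset)
qed

lemma finite_boundary:
  assumes "locally_finite_graph E" "finite K"
  shows "finite (vertex_boundary E K)"
proof (rule finite_subset)
  show "vertex_boundary E K \<subseteq> (\<Union>u\<in>K. {v. {u, v} \<in> E})"
    by (auto simp: vertex_boundary_def)
  show "finite (\<Union>u\<in>K. {v. {u, v} \<in> E})"
    using assms by (auto simp: locally_finite_graph_def)
qed

locale edge_order =
  fixes E :: "'v set set" and R :: "'v set \<Rightarrow> 'v set \<Rightarrow> bool"
  assumes simple: "simple_graph E"
    and loc_fin: "locally_finite_graph E"
    and irrefl: "\<not> R e e"
    and trans: "R e f \<Longrightarrow> R f g \<Longrightarrow> R e g"
    and total: "e \<in> E \<Longrightarrow> f \<in> E \<Longrightarrow> e \<noteq> f \<Longrightarrow> R e f \<or> R f e"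
begin

lemma least_exists:
  assumes "finite S" "S \<noteq> {}" "S \<subseteq> E"
  shows "\<exists>e. least_edge R e S"
  using assms
proof (induction rule: finite_ne_induct)
  case (insert f S)
  then obtain e where e: "least_edge R e S" by auto
  then have "e \<in> S" and e_least: "\<And>g. g \<in> S \<Longrightarrow> g \<noteq> e \<Longrightarrow> R e g"
    by (auto simp: least_edge_def)
  then consider "R e f" | "R f e" using total[of e f] insert by auto
  then show ?case
  proof cases
    case 1
    then have "least_edge R e (insert f S)"
      using \<open>e \<in> S\<close> e_least by (auto simp: least_edge_def)
    then show ?thesis ..
  next
    case 2
    then have "R f g" if "g \<in> S" for g
      using e_least[OF that] trans[of f e g] by (cases "g = e") auto
    then have "least_edge R f (insert f S)" by (simp add: least_edge_def)
    then show ?thesis ..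
  qed
qed (auto simp: least_edge_def)

lemma greatest_exists:
  assumes "finite S" "S \<noteq> {}" "S \<subseteq> E"
  shows "\<exists>e\<in>S. \<forall>f\<in>S. f \<noteq> e \<longrightarrow> R f e"
proof -
  interpret conv: edge_order E "\<lambda>e f. R f e"
    using simple loc_fin irrefl trans total by unfold_locales blast+
  show ?thesis using conv.least_exists[OF assms] by (auto simp: least_edge_def)
qed

lemma free_forest_subset: "free_forest E R \<subseteq> E"
  by (auto simp: free_forest_def)

text \<open>
  A path between the ends of an edge of the free forest would close up to a cycle inside the free
  forest, but the least edge of that cycle has been deleted.
\<close>

lemma free_forest_bridge:
  assumes "{a, b} \<in> free_forest E R"
  shows "\<not> linked (free_forest E R - {{a, b}}) a b"
proof
  let ?F = "free_forest E R"
  assume "linked (?F - {{a, b}}) a b"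
  then obtain xs where xs: "xs \<noteq> []" "distinct xs" "hd xs = a" "last xs = b"
    and steps: "\<And>i. Suc i < length xs \<Longrightarrow> {xs ! i, xs ! Suc i} \<in> ?F - {{a, b}}"
    using linked_simple_path by metis
  have "card {a, b} = 2" using assms simple free_forest_subset by (auto simp: simple_graph_def)
  then have "a \<noteq> b" by auto
  have len: "3 \<le> length xs"
  proof (rule ccontr)
    assume "\<not> 3 \<le> length xs"
    moreover have "length xs \<noteq> 0" using xs(1) by simp
    ultimately have "length xs = 1 \<or> length xs = 2" by linarith
    then show False
    proof
      assume "length xs = 1"
      then show False using xs \<open>a \<noteq> b\<close> by (auto simp: length_Suc_conv)
    next
      assume 2: "length xs = 2"
      then have "{xs ! 0, xs ! 1} = {a, b}"
        using xs by (auto simp: hd_conv_nth last_conv_nth)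
      then show False using steps[of 0] 2 by auto
    qed
  qed
  have sub: "cycle_edges xs \<subseteq> ?F"
  proof
    fix f assume "f \<in> cycle_edges xs"
    then obtain i where i: "i < length xs" "f = {xs ! i, xs ! (Suc i mod length xs)}"
      by (auto simp: cycle_edges_def)
    show "f \<in> ?F"
    proof (cases "Suc i < length xs")
      case True
      then show ?thesis using steps[of i] i by simp
    next
      case False
      then have "Suc i = length xs" using i by simp
      then have "f = {b, a}"
        using i xs by (simp add: hd_conv_nth last_conv_nth flip: \<open>Suc i = length xs\<close>)
      then show ?thesis using assms by (simp add: insert_commute)
    qed
  qed
  have "finite (cycle_edges xs)" by (auto simp: cycle_edges_def)
  moreover have "cycle_edges xs \<noteq> {}" using len by (force simp: cycle_edges_def)
  ultimately obtain f where f: "least_edge R f (cycle_edges xs)"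
    using least_exists sub free_forest_subset by blast
  moreover have "cycle_edges xs \<in> finite_cycles E"
    using len xs(2) sub free_forest_subset by (auto simp: finite_cycles_def)
  ultimately have "f \<notin> ?F" by (auto simp: free_forest_def)
  moreover have "f \<in> ?F" using f sub by (auto simp: least_edge_def)
  ultimately show False by simp
qed

text \<open>
  If the cluster \<open>A\<close> were finite, there would be a greatest edge \<open>f\<close> above \<open>e\<close> that crosses \<open>A\<close>.
  It is in the free forest, since a cycle through \<open>f\<close> crosses \<open>A\<close> a second time, necessarily at a
  smaller edge.  It is not an excess edge, since no edge above \<open>f\<close> crosses \<open>A\<close>.  Hence \<open>f\<close> is one
  of the edges that span the cluster, and it cannot lead out of it.
\<close>

lemma infinite_cluster_above_escaping_edge:
  assumes e: "escapes E R e" "x \<in> e"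
  shows "infinite {z. linked {f \<in> free_forest E R - excess_edges E R. R e f} x z}"
    (is "infinite ?A")
proof
  assume fin: "finite ?A"
  let ?S = "{f \<in> E. crosses ?A f \<and> R e f}"
  have "x \<in> ?A" by simp
  with e fin have "?S \<noteq> {}" unfolding escapes_def by blast
  moreover have "finite ?S"
    by (rule finite_subset[OF _ finite_incident[OF simple loc_fin fin]]) (auto simp: crosses_def)
  ultimately obtain f where f: "f \<in> ?S" and max: "\<forall>g\<in>?S. g \<noteq> f \<longrightarrow> R g f"
    using greatest_exists[of ?S] by blast
  have max': "\<not> R f g" if "g \<in> ?S" for g
    using max that trans[of f g f] irrefl by (cases "g = f") auto
  have "f \<in> free_forest E R"
  proof (rule ccontr)
    assume "f \<notin> free_forest E R"
    then obtain C where C: "C \<in> finite_cycles E" "least_edge R f C"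
      using f by (auto simp: free_forest_def)
    then obtain xs where xs: "C = cycle_edges xs" "3 \<le> length xs" "distinct xs" "C \<subseteq> E"
      by (auto simp: finite_cycles_def)
    then obtain f' where f': "f' \<in> C" "f' \<noteq> f" "crosses ?A f'"
      using cycle_crosses_twice[of xs f ?A] C f by (auto simp: least_edge_def)
    then have "R f f'" using C by (auto simp: least_edge_def)
    then show False using max'[of f'] f f' xs(4) trans[of e f f'] by auto
  qed
  moreover have "f \<notin> excess_edges E R"
  proof
    assume "f \<in> excess_edges E R"
    moreover have "f \<inter> ?A \<noteq> {}" using f by (simp add: crosses_def)
    ultimately obtain g where "g \<in> E" "crosses ?A g" "R f g"
      using fin unfolding excess_edges_def escapes_def by blast
    then show False using max'[of g] f trans[of e f g] by auto
  qed
  ultimately have fS: "f \<in> {f \<in> free_forest E R - excess_edges E R. R e f}" using f by auto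
  obtain y z where yz: "f = {y, z}" using f edge_ends[OF simple] by blast
  have "linked T x y \<longleftrightarrow> linked T x z" if "{y, z} \<in> T" for T
    using that linked_step[of T x y z] linked_step[of T x z y] by (auto simp: insert_commute)
  from this[OF fS[unfolded yz]] have "y \<in> ?A \<longleftrightarrow> z \<in> ?A" unfolding mem_Collect_eq .
  moreover have "crosses ?A f" using f by (rule CollectE) (elim conjE)
  then have "y \<in> ?A \<longleftrightarrow> z \<notin> ?A" unfolding yz by (rule crosses_pair[THEN iffD1])
  ultimately show False by (cases "y \<in> ?A") (simp_all only: simp_thms)
qed

text \<open>
  Here \<open>y\<close> and \<open>y'\<close> are the ends of the two edges on the side of the root \<open>r\<close>, and \<open>x\<close>, \<open>x'\<close> are
  the far ends.  After contracting the clusters of non-excess edges, an excess edge is determined by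
  the cluster of its far end, because it is the unique edge from that cluster towards the root.
  Since both edges are bridges of the free forest, this reduces to connectivity in the forest without
  the two edges, to which the edges are added back one at a time.
\<close>

lemma far_end_unique:
  assumes e: "{x, y} \<in> excess_edges E R" and e': "{x', y'} \<in> excess_edges E R"
    and root: "linked (free_forest E R - {{x, y}}) y r" "linked (free_forest E R - {{x', y'}}) y' r"
    and near: "linked (free_forest E R - excess_edges E R) x x'"
  shows "{x, y} = {x', y'}"
proof (rule ccontr)
  assume ne: "{x, y} \<noteq> {x', y'}"
  let ?F = "free_forest E R"
  let ?S = "?F - {{x, y}, {x', y'}}"
  have F: "{x, y} \<in> ?F" "{x', y'} \<in> ?F" using e e' by (auto simp: excess_edges_def)
  have eq: "?F - {{x, y}} = insert {x', y'} ?S" "?F - {{x', y'}} = insert {x, y} ?S"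
    using F ne by auto
  have xx': "linked ?S x x'" by (rule linked_mono[OF near]) (use e e' in auto)
  have no1: "\<not> linked (insert {x', y'} ?S) x y"
    using free_forest_bridge[OF F(1)] by (simp add: eq)
  have noS: "\<not> linked ?S x y"
    using no1 linked_mono[of ?S x y "insert {x', y'} ?S"] by blast
  have noyy': "\<not> linked ?S y y'"
  proof
    assume yy': "linked ?S y y'"
    have "linked (insert {x', y'} ?S) x x'" by (rule linked_mono[OF xx']) auto
    also have "linked (insert {x', y'} ?S) x' y'" by (rule linked_edge) auto
    also have "linked (insert {x', y'} ?S) y' y"
      by (rule linked_mono[OF linked_sym[OF yy']]) auto
    finally show False using no1 by contradiction
  qed
  have noS': "\<not> linked ?S x' y'"
    using free_forest_bridge[OF F(2)] linked_mono[of ?S x' y' "?F - {{x', y'}}"] by blast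
  have "\<not> linked ?S y x'"
    using noS linked_trans[OF xx' linked_sym[of ?S y x']] by blast
  then have yr: "linked ?S y r"
    using linked_insert[OF root(1)[unfolded eq]] noyy' by blast
  have "\<not> linked ?S y' x"
    using noS' linked_trans[OF linked_sym[OF xx'] linked_sym[of ?S y' x]] by blast
  then have "linked ?S y' r"
    using linked_insert[OF root(2)[unfolded eq]] noyy' linked_sym[of ?S y' y] by blast
  from linked_trans[OF yr linked_sym[OF this]] noyy' show False by contradiction
qed

text \<open>
  Each excess edge is sent to a vertex at which the boundary of \<open>K\<close> is reached from its far end
  through non-excess edges above it.  Two edges with the same image have linked far ends, so they
  coincide by uniqueness of the edge towards the root.
\<close>

lemma boundary_injection:
  assumes K: "finite K"
  shows "\<exists>b. inj_on b {e \<in> excess_edges E R. e \<inter> K \<noteq> {}} \<and>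
             (\<forall>e\<in>{e \<in> excess_edges E R. e \<inter> K \<noteq> {}}. b e \<in> vertex_boundary E K \<and>
                (b e \<in> e \<or> (\<exists>f\<in>E. R e f \<and> b e \<in> f)))"
proof -
  let ?F = "free_forest E R" and ?D = "{e \<in> excess_edges E R. e \<inter> K \<noteq> {}}"
  let ?W = "free_forest E R - excess_edges E R"
  \<comment> \<open>The choice depends only on the set of vertices linked to \<open>x\<close>, so each tree gets one root.\<close>
  define root where "root x = (SOME r. linked ?F x r)" for x
  have root: "linked ?F x (root x)" for x
    unfolding root_def by (rule someI[of _ x]) simp
  have root_eq: "root x = root y" if "linked ?F x y" for x y
    unfolding root_def
    by (rule arg_cong[where f = Eps]) (use that linked_trans[of ?F] linked_sym[of ?F] in blast)
  \<comment> \<open>A link to the root need not use \<open>e\<close> more than once, so from one of the ends, called \<open>y\<close>,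
      it does not use \<open>e\<close> at all.\<close>
  have far: "\<exists>x y. e = {x, y} \<and> linked (?F - {e}) y (root y)" if "e \<in> ?D" for e
  proof -
    from that have eF: "e \<in> ?F" by (auto simp: excess_edges_def)
    then obtain x y where e: "e = {x, y}" using free_forest_subset edge_ends[OF simple] by blast
    have "insert {x, y} (?F - {e}) = ?F" using eF e by auto
    then have "linked (insert {x, y} (?F - {e})) y (root y)" using root by simp
    moreover have "root x = root y" by (rule root_eq[OF linked_edge]) (use eF e in simp)
    ultimately have "linked (?F - {e}) y (root y) \<or> linked (?F - {e}) x (root x)"
      by (auto dest!: linked_insert)
    then show ?thesis using e by (metis insert_commute)
  qed
  \<comment> \<open>An infinite cluster at \<open>x\<close> is not contained in \<open>K\<close>; the first vertex outside \<open>K\<close> on a walk in it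
      is a boundary vertex.\<close>
  have exit: "\<exists>v. v \<in> vertex_boundary E K \<and> (v \<in> e \<or> (\<exists>f\<in>E. R e f \<and> v \<in> f)) \<and> linked ?W x v"
    if e: "e \<in> ?D" "e = {x, y}" for e x y
  proof (cases "x \<in> K")
    case False
    then have "x \<in> vertex_boundary E K"
      using e by (auto simp: vertex_boundary_def excess_edges_def free_forest_def insert_commute)
    then show ?thesis using e by auto
  next
    case True
    let ?S = "{f \<in> ?W. R e f}"
    have "escapes E R e" "x \<in> e" using e by (auto simp: excess_edges_def)
    then have inf: "infinite {z. linked ?S x z}" by (rule infinite_cluster_above_escaping_edge)
    have "\<not> {z. linked ?S x z} \<subseteq> K"
      using inf finite_subset[OF _ K, of "{z. linked ?S x z}"] by (rule contrapos_nn)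
    then obtain z where z: "linked ?S x z" "z \<notin> K" by auto
    have "z \<in> K \<or> (\<exists>v. v \<in> vertex_boundary E K \<and> (\<exists>f\<in>E. R e f \<and> v \<in> f) \<and> linked ?W x v)"
      using z(1)
    proof (induction rule: linked_induct)
      case refl
      then show ?case using True by simp
    next
      case (step u v)
      have "{u, v} \<in> E" using step.hyps free_forest_subset by blast
      moreover have "linked ?W x v"
        by (rule linked_mono[OF linked_step[OF step.hyps]]) auto
      ultimately have "v \<notin> K \<and> u \<in> K \<longrightarrow>
        v \<in> vertex_boundary E K \<and> (\<exists>f\<in>E. R e f \<and> v \<in> f) \<and> linked ?W x v"
        using step.hyps by (auto simp: vertex_boundary_def)
      then show ?case using step.IH by blast
    qed
    then show ?thesis using z(2) by blast
  qed
  have "\<forall>e\<in>?D. \<exists>v x y. e = {x, y} \<and> linked (?F - {e}) y (root y) \<and>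
      v \<in> vertex_boundary E K \<and> (v \<in> e \<or> (\<exists>f\<in>E. R e f \<and> v \<in> f)) \<and> linked ?W x v"
  proof
    fix e assume e: "e \<in> ?D"
    from far[OF e] obtain x y where xy: "e = {x, y}" "linked (?F - {e}) y (root y)" by blast
    from exit[OF e xy(1)] xy
    show "\<exists>v x y. e = {x, y} \<and> linked (?F - {e}) y (root y) \<and>
      v \<in> vertex_boundary E K \<and> (v \<in> e \<or> (\<exists>f\<in>E. R e f \<and> v \<in> f)) \<and> linked ?W x v"
      by iprover
  qed
  then obtain b where b: "\<forall>e\<in>?D. \<exists>x y. e = {x, y} \<and> linked (?F - {e}) y (root y) \<and>
      b e \<in> vertex_boundary E K \<and> (b e \<in> e \<or> (\<exists>f\<in>E. R e f \<and> b e \<in> f)) \<and> linked ?W x (b e)"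
    by (rule bchoice[THEN exE])
  have "inj_on b ?D"
  proof (rule inj_onI)
    fix e e' assume e: "e \<in> ?D" and e': "e' \<in> ?D" and eq: "b e = b e'"
    obtain x y where xy: "e = {x, y}" "linked (?F - {e}) y (root y)" "linked ?W x (b e)"
      using bspec[OF b e] by blast
    obtain x' y' where xy': "e' = {x', y'}" "linked (?F - {e'}) y' (root y')" "linked ?W x' (b e')"
      using bspec[OF b e'] by blast
    have near: "linked ?W x x'" using linked_trans[OF xy(3) linked_sym] xy'(3) eq by simp
    have "linked ?F x y" "linked ?F x' y'"
      using e e' xy(1) xy'(1) by (auto intro!: linked_edge simp: excess_edges_def)
    moreover have "linked ?F x x'" by (rule linked_mono[OF near]) auto
    ultimately have "root y = root y'" using root_eq by metis
    then show "e = e'"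
      using far_end_unique[of x y x' y' "root y"] e e' xy xy' near by auto
  qed
  then show ?thesis using b by (intro exI[of _ b]) blast
qed

text \<open>
  The boundary vertex assigned to \<open>e\<close> is an end of \<open>e\<close> or of an edge above \<open>e\<close>, so its weight is at
  least the score of \<open>e\<close>, and no boundary vertex is used twice.
\<close>

lemma sum_excess_le_boundary:
  assumes K: "finite K"
    and mono: "\<And>e f. R e f \<Longrightarrow> Y e \<le> Y f"
    and le: "\<And>e v. e \<in> E \<Longrightarrow> v \<in> e \<Longrightarrow> Y e \<le> w v"
    and nonneg: "\<And>v. 0 \<le> (w v :: real)"
  shows "(\<Sum>e\<in>{e \<in> excess_edges E R. e \<inter> K \<noteq> {}}. Y e) \<le> sum w (vertex_boundary E K)"
proof -
  let ?D = "{e \<in> excess_edges E R. e \<inter> K \<noteq> {}}"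
  obtain b where b: "inj_on b ?D"
    "\<And>e. e \<in> ?D \<Longrightarrow> b e \<in> vertex_boundary E K \<and> (b e \<in> e \<or> (\<exists>f\<in>E. R e f \<and> b e \<in> f))"
    using boundary_injection[OF K] by blast
  have "Y e \<le> w (b e)" if "e \<in> ?D" for e
  proof -
    have "e \<in> E" using that by (auto simp: excess_edges_def free_forest_def)
    then show ?thesis using b(2)[OF that] le mono by (meson order_trans)
  qed
  then have "sum Y ?D \<le> sum (\<lambda>e. w (b e)) ?D" by (rule sum_mono)
  also have "\<dots> = sum w (b ` ?D)" by (simp add: sum.reindex b(1))
  also have "\<dots> \<le> sum w (vertex_boundary E K)"
    by (rule sum_mono2[OF finite_boundary[OF loc_fin K]]) (use b(2) nonneg in auto)
  finally show ?thesis .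
qed

end


section \<open>Relative weights\<close>

text \<open>
  The orbit of the pair fibres over the orbit of \<open>z\<close>, and all fibres are translates of the orbit of
  \<open>y\<close> under the stabilizer of \<open>z\<close>.
\<close>

lemma card_orbit_pair:
  assumes bij: "\<And>\<gamma>. \<gamma> \<in> H \<Longrightarrow> bij \<gamma>"
    and comp: "\<And>\<gamma> \<delta>. \<gamma> \<in> H \<Longrightarrow> \<delta> \<in> H \<Longrightarrow> \<gamma> \<circ> \<delta> \<in> H"
    and inv: "\<And>\<gamma>. \<gamma> \<in> H \<Longrightarrow> inv_into UNIV \<gamma> \<in> H"
    and fin: "finite ((\<lambda>\<gamma>. \<gamma> z) ` H)" "finite ((\<lambda>\<gamma>. \<gamma> y) ` H)"
  shows "card ((\<lambda>\<gamma>. (\<gamma> z, \<gamma> y)) ` H) =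
         card ((\<lambda>\<gamma>. \<gamma> z) ` H) * card ((\<lambda>\<gamma>. \<gamma> y) ` {\<gamma> \<in> H. \<gamma> z = z})"
proof -
  let ?Z = "(\<lambda>\<gamma>. \<gamma> z) ` H" and ?S = "(\<lambda>\<gamma>. \<gamma> y) ` {\<gamma> \<in> H. \<gamma> z = z}"
  let ?B = "\<lambda>a. (\<lambda>\<gamma>. \<gamma> y) ` {\<gamma> \<in> H. \<gamma> z = a}"
  have "(\<lambda>\<gamma>. (\<gamma> z, \<gamma> y)) ` H = Sigma ?Z ?B"
    by (auto intro: rev_image_eqI)
  moreover have "card (?B a) = card ?S" if "a \<in> ?Z" for a
  proof -
    from that obtain \<delta> where \<delta>: "\<delta> \<in> H" "a = \<delta> z" by blast
    have "?B a = \<delta> ` ?S"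
    proof (intro equalityI subsetI)
      fix b assume "b \<in> ?B a"
      then obtain \<gamma> where \<gamma>: "\<gamma> \<in> H" "\<gamma> z = \<delta> z" "b = \<gamma> y" using \<delta> by auto
      have "inv_into UNIV \<delta> \<circ> \<gamma> \<in> {\<gamma> \<in> H. \<gamma> z = z}"
        using \<gamma> \<delta> bij[OF \<delta>(1)] by (simp add: comp inv bij_is_inj)
      moreover have "\<delta> ((inv_into UNIV \<delta> \<circ> \<gamma>) y) = b"
        using \<gamma>(3) bij[OF \<delta>(1)] by (simp add: bij_is_surj surj_f_inv_f)
      ultimately show "b \<in> \<delta> ` ?S" by (metis (no_types, lifting) imageI)
    next
      fix b assume "b \<in> \<delta> ` ?S"
      then obtain \<gamma> where \<gamma>: "\<gamma> \<in> H" "\<gamma> z = z" "b = \<delta> (\<gamma> y)" by blast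
      have "\<delta> \<circ> \<gamma> \<in> {\<gamma> \<in> H. \<gamma> z = a}" using \<gamma> \<delta> comp by simp
      then have "(\<delta> \<circ> \<gamma>) y \<in> ?B a" by (rule imageI)
      then show "b \<in> ?B a" using \<gamma>(3) by simp
    qed
    then show ?thesis
      using card_image[OF inj_on_subset[OF bij_is_inj[OF bij[OF \<delta>(1)]] subset_UNIV]] by simp
  qed
  moreover have "finite (?B a)" for a by (rule finite_subset[OF _ fin(2)]) auto
  ultimately show ?thesis using fin(1) by (simp add: card_SigmaI)
qed

locale automorphism_subgroup =
  fixes E :: "'v set set" and \<Gamma> :: "('v \<Rightarrow> 'v) set"
  assumes simple: "simple_graph E"
    and loc_fin: "locally_finite_graph E"
    and connected: "connected_graph E"
    and one_mem: "(\<lambda>x. x) \<in> \<Gamma>"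
    and comp_mem: "\<gamma> \<in> \<Gamma> \<Longrightarrow> \<delta> \<in> \<Gamma> \<Longrightarrow> \<gamma> \<circ> \<delta> \<in> \<Gamma>"
    and inv_mem: "\<gamma> \<in> \<Gamma> \<Longrightarrow> inv_into UNIV \<gamma> \<in> \<Gamma>"
    and bij: "\<gamma> \<in> \<Gamma> \<Longrightarrow> bij \<gamma>"
    and edge_iff: "\<gamma> \<in> \<Gamma> \<Longrightarrow> {\<gamma> x, \<gamma> y} \<in> E \<longleftrightarrow> {x, y} \<in> E"

lemma automorphism_subgroupI:
  assumes "simple_graph E" "locally_finite_graph E" "connected_graph E" "closed_subgroup_Aut \<Gamma> E"
  shows "automorphism_subgroup E \<Gamma>"
proof -
  from assms(4) have sub: "subgroup \<Gamma> (Aut_group E)" by (simp add: closed_subgroup_Aut_def)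
  have carrier: "carrier (Aut_group E) = {f. bij f \<and> (\<forall>x y. {f x, f y} \<in> E \<longleftrightarrow> {x, y} \<in> E)}"
    by (auto simp: Aut_group_def Bij_def)
  then have \<Gamma>: "bij \<gamma>" "{\<gamma> x, \<gamma> y} \<in> E \<longleftrightarrow> {x, y} \<in> E" if "\<gamma> \<in> \<Gamma>" for \<gamma> x y
    using subgroup.subset[OF sub] that by auto
  have mult: "f \<otimes>\<^bsub>Aut_group E\<^esub> g = f \<circ> g" if "bij f" "bij g" for f g
    using that by (auto simp: Aut_group_def BijGroup_def Bij_def compose_def)
  have one: "\<one>\<^bsub>Aut_group E\<^esub> = (\<lambda>x. x)" by (simp add: Aut_group_def BijGroup_def restrict_def)
  have inv: "inv\<^bsub>Aut_group E\<^esub> \<gamma> = inv_into UNIV \<gamma>" if "\<gamma> \<in> \<Gamma>" for \<gamma>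
    unfolding m_inv_def
  proof (rule the_equality)
    have b: "bij \<gamma>" "bij (inv_into UNIV \<gamma>)" using \<Gamma>(1)[OF that] bij_imp_bij_inv by auto
    have "{inv_into UNIV \<gamma> x, inv_into UNIV \<gamma> y} \<in> E \<longleftrightarrow> {x, y} \<in> E" for x y
      using \<Gamma>(2)[OF that, of "inv_into UNIV \<gamma> x" "inv_into UNIV \<gamma> y"] b(1) by (simp add: bij_is_surj surj_f_inv_f)
    then show "inv_into UNIV \<gamma> \<in> carrier (Aut_group E) \<and> \<gamma> \<otimes>\<^bsub>Aut_group E\<^esub> inv_into UNIV \<gamma> = \<one>\<^bsub>Aut_group E\<^esub> \<and>
        inv_into UNIV \<gamma> \<otimes>\<^bsub>Aut_group E\<^esub> \<gamma> = \<one>\<^bsub>Aut_group E\<^esub>"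
      using b by (auto simp: carrier mult one fun_eq_iff bij_is_surj surj_f_inv_f bij_is_inj)
    fix f assume f: "f \<in> carrier (Aut_group E) \<and> \<gamma> \<otimes>\<^bsub>Aut_group E\<^esub> f = \<one>\<^bsub>Aut_group E\<^esub> \<and>
        f \<otimes>\<^bsub>Aut_group E\<^esub> \<gamma> = \<one>\<^bsub>Aut_group E\<^esub>"
    then have "bij f" by (simp add: carrier)
    then have "\<gamma> \<circ> f = (\<lambda>x. x)" "f \<circ> \<gamma> = (\<lambda>x. x)" using f b by (simp_all add: mult one)
    then have "inv_into UNIV \<gamma> = f" by (intro inv_unique_comp) (simp_all add: id_def)
    then show "f = inv_into UNIV \<gamma>" by simp
  qed
  show ?thesis
  proof
    show "(\<lambda>x. x) \<in> \<Gamma>" using subgroup.one_closed[OF sub] by (simp add: one)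
    show "\<gamma> \<circ> \<delta> \<in> \<Gamma>" if "\<gamma> \<in> \<Gamma>" "\<delta> \<in> \<Gamma>" for \<gamma> \<delta>
      using subgroup.m_closed[OF sub that] \<Gamma>(1) that by (simp add: mult)
    show "inv_into UNIV \<gamma> \<in> \<Gamma>" if "\<gamma> \<in> \<Gamma>" for \<gamma>
      using subgroup.m_inv_closed[OF sub that] inv[OF that] by simp
  qed (use assms \<Gamma> in auto)
qed

context automorphism_subgroup
begin

lemma finite_stabilizer_orbit: "finite ((\<lambda>\<gamma>. \<gamma> y) ` vertex_stabilizer \<Gamma> x)"
proof -
  have "(x, y) \<in> {(u, v). {u, v} \<in> E}\<^sup>*" using connected by (simp add: connected_graph_def)
  then show ?thesis
  proof (induction rule: rtrancl_induct)
    case base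
    show ?case by (rule finite_subset[of _ "{x}"]) (auto simp: vertex_stabilizer_def)
  next
    case (step y z)
    have "(\<lambda>\<gamma>. \<gamma> z) ` vertex_stabilizer \<Gamma> x
        \<subseteq> (\<Union>y'\<in>(\<lambda>\<gamma>. \<gamma> y) ` vertex_stabilizer \<Gamma> x. {z'. {y', z'} \<in> E})"
      using step.hyps(2) edge_iff by (auto simp: vertex_stabilizer_def)
    moreover have "finite (\<Union>y'\<in>(\<lambda>\<gamma>. \<gamma> y) ` vertex_stabilizer \<Gamma> x. {z'. {y', z'} \<in> E})"
      using step.IH loc_fin by (intro finite_UN_I) (auto simp: locally_finite_graph_def)
    ultimately show ?case by (rule finite_subset)
  qed
qed

abbreviation orbit_size :: "'v \<Rightarrow> 'v \<Rightarrow> nat" where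
  "orbit_size x y \<equiv> card ((\<lambda>\<gamma>. \<gamma> y) ` vertex_stabilizer \<Gamma> x)"

lemma orbit_size_pos: "0 < orbit_size x y"
  using finite_stabilizer_orbit one_mem by (auto simp: card_gt_0_iff vertex_stabilizer_def)

lemma rel_weight_pos: "0 < rel_weight \<Gamma> y x"
  using orbit_size_pos by (simp add: rel_weight_def)

text \<open>
  The orbit of a pair under a stabilizer can be counted by fixing either coordinate first.  Doing so
  for the stabilizers of \<open>x\<close>, \<open>y\<close> and \<open>z\<close> brings in the orbits under the three joint stabilizers of
  two points, and these cancel in the product.
\<close>

lemma orbit_size_cocycle:
  "orbit_size x z * orbit_size z y * orbit_size y x =
   orbit_size z x * orbit_size x y * orbit_size y z"
proof -
  define triple where "triple a b c =
    card ((\<lambda>\<gamma>. \<gamma> c) ` {\<gamma> \<in> \<Gamma>. \<gamma> a = a \<and> \<gamma> b = b})" for a b c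
  have swap: "triple a b c = triple b a c" for a b c
    by (simp add: triple_def conj_commute)
  have inv_fix: "inv_into UNIV \<gamma> a = a" if "\<gamma> \<in> \<Gamma>" "\<gamma> a = a" for \<gamma> a
    using bij[OF that(1)] that(2) by (metis bij_is_inj inv_f_f)
  have pair: "card ((\<lambda>\<gamma>. (\<gamma> b, \<gamma> c)) ` vertex_stabilizer \<Gamma> a) = orbit_size a b * triple a b c"
    for a b c
  proof -
    have "{\<gamma> \<in> vertex_stabilizer \<Gamma> a. \<gamma> b = b} = {\<gamma> \<in> \<Gamma>. \<gamma> a = a \<and> \<gamma> b = b}"
      by (auto simp: vertex_stabilizer_def)
    then show ?thesis
      unfolding triple_def
      by (subst card_orbit_pair)
         (use finite_stabilizer_orbit in \<open>auto simp: vertex_stabilizer_def bij comp_mem inv_mem inv_fix\<close>)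
  qed
  have pair_swap: "orbit_size a b * triple a b c = orbit_size a c * triple a c b" for a b c
  proof -
    have "(\<lambda>\<gamma>. (\<gamma> c, \<gamma> b)) ` vertex_stabilizer \<Gamma> a =
        prod.swap ` (\<lambda>\<gamma>. (\<gamma> b, \<gamma> c)) ` vertex_stabilizer \<Gamma> a"
      by (simp add: image_image)
    then show ?thesis
      using pair[where a = a and b = b and c = c] pair[where a = a and b = c and c = b] by (simp add: card_image)
  qed
  have triple_nonzero: "triple a b c \<noteq> 0" for a b c
  proof -
    have "finite ((\<lambda>\<gamma>. \<gamma> c) ` {\<gamma> \<in> \<Gamma>. \<gamma> a = a \<and> \<gamma> b = b})"
      by (rule finite_subset[OF _ finite_stabilizer_orbit[of c a]]) (auto simp: vertex_stabilizer_def)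
    then show ?thesis using one_mem by (auto simp: triple_def card_gt_0_iff)
  qed
  have "(orbit_size x z * triple x z y) * (orbit_size z y * triple z y x) *
        (orbit_size y x * triple x y z) =
      (orbit_size x y * triple x y z) * (orbit_size z x * triple x z y) *
        (orbit_size y z * triple z y x)"
    using pair_swap[of x z y] pair_swap[of z y x] pair_swap[of y x z] swap[of z x y] swap[of y z x]
      swap[of y x z] by simp
  then have "(orbit_size x z * orbit_size z y * orbit_size y x) *
      (triple x z y * triple z y x * triple x y z) =
    (orbit_size z x * orbit_size x y * orbit_size y z) *
      (triple x z y * triple z y x * triple x y z)"
    by (simp only: mult_ac)
  then show ?thesis by (simp add: triple_nonzero)
qed

lemma orbit_size_translate:
  assumes "\<delta> \<in> \<Gamma>"
  shows "orbit_size (\<delta> x) (\<delta> y) = orbit_size x y"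
proof -
  have b: "bij \<delta>" using bij assms .
  have "(\<lambda>\<gamma>. \<gamma> (\<delta> y)) ` vertex_stabilizer \<Gamma> (\<delta> x) = \<delta> ` (\<lambda>\<gamma>. \<gamma> y) ` vertex_stabilizer \<Gamma> x"
  proof (intro equalityI subsetI)
    fix v assume "v \<in> (\<lambda>\<gamma>. \<gamma> (\<delta> y)) ` vertex_stabilizer \<Gamma> (\<delta> x)"
    then obtain \<gamma> where \<gamma>: "\<gamma> \<in> \<Gamma>" "\<gamma> (\<delta> x) = \<delta> x" "v = \<gamma> (\<delta> y)"
      by (auto simp: vertex_stabilizer_def)
    then have "inv_into UNIV \<delta> \<circ> (\<gamma> \<circ> \<delta>) \<in> vertex_stabilizer \<Gamma> x"
      using assms b by (simp add: vertex_stabilizer_def comp_mem inv_mem bij_is_inj)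
    moreover have "v = \<delta> ((inv_into UNIV \<delta> \<circ> (\<gamma> \<circ> \<delta>)) y)"
      using \<gamma>(3) b by (simp add: bij_is_surj surj_f_inv_f)
    ultimately show "v \<in> \<delta> ` (\<lambda>\<gamma>. \<gamma> y) ` vertex_stabilizer \<Gamma> x" by blast
  next
    fix v assume "v \<in> \<delta> ` (\<lambda>\<gamma>. \<gamma> y) ` vertex_stabilizer \<Gamma> x"
    then obtain \<gamma> where \<gamma>: "\<gamma> \<in> \<Gamma>" "\<gamma> x = x" "v = \<delta> (\<gamma> y)"
      by (auto simp: vertex_stabilizer_def)
    then have "\<delta> \<circ> (\<gamma> \<circ> inv_into UNIV \<delta>) \<in> vertex_stabilizer \<Gamma> (\<delta> x)"
      using assms b by (simp add: vertex_stabilizer_def comp_mem inv_mem bij_is_inj)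
    moreover have "v = (\<delta> \<circ> (\<gamma> \<circ> inv_into UNIV \<delta>)) (\<delta> y)"
      using \<gamma>(3) b by (simp add: bij_is_inj)
    ultimately show "v \<in> (\<lambda>\<gamma>. \<gamma> (\<delta> y)) ` vertex_stabilizer \<Gamma> (\<delta> x)" by blast
  qed
  then show ?thesis using b by (simp add: card_image bij_is_inj inj_on_subset[OF bij_is_inj])
qed

text \<open>
  Since the factor does not depend on \<open>x\<close>, orders that are invariant under a common rescaling of
  the weights have a law that is invariant under the group.
\<close>

lemma rel_weight_translate:
  assumes "\<gamma> \<in> \<Gamma>"
  shows "rel_weight \<Gamma> r (\<gamma> x) = rel_weight \<Gamma> r (\<gamma> r) * rel_weight \<Gamma> r x"
proof -
  have "real (orbit_size (\<gamma> x) r * orbit_size r (\<gamma> r) * orbit_size (\<gamma> r) (\<gamma> x)) =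
      real (orbit_size r (\<gamma> x) * orbit_size (\<gamma> x) (\<gamma> r) * orbit_size (\<gamma> r) r)"
    using orbit_size_cocycle[of "\<gamma> x" r "\<gamma> r"] by simp
  then show ?thesis
    using orbit_size_translate[OF assms] orbit_size_pos
    by (simp add: rel_weight_def field_simps less_imp_neq[THEN not_sym])
qed

end


section \<open>Dependence of the forests on the edge order\<close>

lemma least_edge_cong:
  assumes "\<And>e f. e \<in> E \<Longrightarrow> f \<in> E \<Longrightarrow> R e f \<longleftrightarrow> R' e f" "C \<subseteq> E"
  shows "least_edge R e C \<longleftrightarrow> least_edge R' e C"
proof -
  have "R e f \<longleftrightarrow> R' e f" if "e \<in> C" "f \<in> C" for e f using assms that by blast
  then show ?thesis unfolding least_edge_def by blast
qed

lemma free_forest_cong: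
  assumes "\<And>e f. e \<in> E \<Longrightarrow> f \<in> E \<Longrightarrow> R e f \<longleftrightarrow> R' e f"
  shows "free_forest E R = free_forest E R'"
proof -
  have "least_edge R e C \<longleftrightarrow> least_edge R' e C" if "C \<in> finite_cycles E" for e C
    by (rule least_edge_cong[of E]) (use assms that in \<open>auto simp: finite_cycles_def\<close>)
  then show ?thesis by (auto simp: free_forest_def)
qed

lemma excess_edges_cong:
  assumes "\<And>e f. e \<in> E \<Longrightarrow> f \<in> E \<Longrightarrow> R e f \<longleftrightarrow> R' e f"
  shows "excess_edges E R = excess_edges E R'"
proof -
  have "escapes E R e \<longleftrightarrow> escapes E R' e" if "e \<in> E" for e
    using assms that by (auto simp: escapes_def)
  moreover have "free_forest E R \<subseteq> E" by (auto simp: free_forest_def)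
  moreover have "free_forest E R = free_forest E R'" by (rule free_forest_cong) (rule assms)
  ultimately show ?thesis by (auto simp: excess_edges_def)
qed

lemma cycle_edges_map: "cycle_edges (map (\<gamma> :: 'a \<Rightarrow> 'b) xs) = (\<lambda>e. \<gamma> ` e) ` cycle_edges xs"
proof -
  have image: "cycle_edges ys = (\<lambda>i. {ys ! i, ys ! (Suc i mod length ys)}) ` {..<length ys}"
    for ys :: "'b list"
    unfolding cycle_edges_def by blast
  have image': "cycle_edges xs = (\<lambda>i. {xs ! i, xs ! (Suc i mod length xs)}) ` {..<length xs}"
    unfolding cycle_edges_def by blast
  have "{map \<gamma> xs ! i, map \<gamma> xs ! (Suc i mod length xs)} = \<gamma> ` {xs ! i, xs ! (Suc i mod length xs)}"
    if "i < length xs" for i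
  proof -
    have "Suc i mod length xs < length xs" using that by (intro mod_less_divisor) linarith
    then show ?thesis using that by simp
  qed
  then show ?thesis unfolding image image' image_image length_map by (intro image_cong) simp_all
qed

lemma finite_cycles_image:
  assumes "bij \<gamma>" "\<And>e. \<gamma> ` e \<in> E \<longleftrightarrow> e \<in> E"
  shows "finite_cycles E = (\<lambda>C. (\<lambda>e. \<gamma> ` e) ` C) ` finite_cycles E"
proof (intro equalityI subsetI)
  fix C assume "C \<in> finite_cycles E"
  then obtain xs where xs: "C = cycle_edges xs" "3 \<le> length xs" "distinct xs" "C \<subseteq> E"
    by (auto simp: finite_cycles_def)
  let ?ys = "map (inv_into UNIV \<gamma>) xs"
  have "map \<gamma> ?ys = xs"
    using assms(1) by (simp add: o_def bij_is_surj surj_f_inv_f)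
  then have C: "C = (\<lambda>e. \<gamma> ` e) ` cycle_edges ?ys" using cycle_edges_map[of \<gamma> ?ys] xs(1) by simp
  moreover have "cycle_edges ?ys \<subseteq> E" using xs(4) unfolding C by (auto simp: assms(2))
  moreover have "distinct ?ys"
    using xs(3) assms(1) bij_imp_bij_inv[of \<gamma>] by (simp add: distinct_map bij_is_inj inj_on_subset[OF bij_is_inj])
  ultimately show "C \<in> (\<lambda>C. (\<lambda>e. \<gamma> ` e) ` C) ` finite_cycles E"
    using xs(2) by (intro image_eqI[of _ _ "cycle_edges ?ys"]) (auto simp: finite_cycles_def)
next
  fix C assume "C \<in> (\<lambda>C. (\<lambda>e. \<gamma> ` e) ` C) ` finite_cycles E"
  then obtain xs where xs: "C = (\<lambda>e. \<gamma> ` e) ` cycle_edges xs" "3 \<le> length xs" "distinct xs"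
      "cycle_edges xs \<subseteq> E"
    by (auto simp: finite_cycles_def)
  then have "C = cycle_edges (map \<gamma> xs)" by (simp add: cycle_edges_map)
  moreover have "cycle_edges (map \<gamma> xs) \<subseteq> E"
    using xs(4) by (auto simp: cycle_edges_map assms(2))
  moreover have "distinct (map \<gamma> xs)"
    using xs(3) assms(1) by (simp add: distinct_map inj_on_subset[OF bij_is_inj])
  ultimately show "C \<in> finite_cycles E"
    using xs(2) unfolding finite_cycles_def mem_Collect_eq
    by (intro exI[of _ "map \<gamma> xs"]) (simp only: length_map)
qed

lemma excess_edges_image:
  assumes bij: "bij \<gamma>" and E: "\<And>e. \<gamma> ` e \<in> E \<longleftrightarrow> e \<in> E"
  shows "\<gamma> ` e \<in> excess_edges E R \<longleftrightarrow> e \<in> excess_edges E (\<lambda>f g. R (\<gamma> ` f) (\<gamma> ` g))"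
proof -
  let ?R = "\<lambda>f g. R (\<gamma> ` f) (\<gamma> ` g)"
  note inj = bij_is_inj[OF bij] and surj = bij_is_surj[OF bij]
  have image_eq: "\<gamma> ` A = \<gamma> ` B \<longleftrightarrow> A = B" for A B by (rule inj_image_eq_iff[OF inj])
  have least: "least_edge R (\<gamma> ` e) ((\<lambda>e. \<gamma> ` e) ` C) \<longleftrightarrow> least_edge ?R e C" for C
    unfolding least_edge_def by (auto simp: image_eq)
  have "\<gamma> ` e \<in> free_forest E R \<longleftrightarrow> e \<in> free_forest E ?R"
    unfolding free_forest_def by (subst finite_cycles_image[OF assms]) (auto simp: E least)
  moreover have "escapes E R (\<gamma> ` e) \<longleftrightarrow> escapes E ?R e"
  proof -
    have edges: "(\<exists>f\<in>E. P f) \<longleftrightarrow> (\<exists>f\<in>E. P (\<gamma> ` f))" for P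
    proof
      assume "\<exists>f\<in>E. P f"
      then obtain f where "f \<in> E" "P f" by blast
      moreover have "\<gamma> ` (inv_into UNIV \<gamma> ` f) = f" by (rule image_f_inv_f[OF surj])
      ultimately show "\<exists>f\<in>E. P (\<gamma> ` f)"
        using E[of "inv_into UNIV \<gamma> ` f"] by (intro bexI[of _ "inv_into UNIV \<gamma> ` f"]) simp_all
    qed (use E in blast)
    have sets: "(\<forall>A. P A) \<longleftrightarrow> (\<forall>A. P (\<gamma> ` A))" for P
      using image_f_inv_f[OF surj] by metis
    have "crosses (\<gamma> ` A) (\<gamma> ` f) \<longleftrightarrow> crosses A f" for A f
      by (simp add: crosses_def inj_image_subset_iff[OF inj] flip: image_Int[OF inj])
    moreover have "finite (\<gamma> ` A) \<longleftrightarrow> finite A" for A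
      using finite_image_iff[OF inj_on_subset[OF inj subset_UNIV]] .
    ultimately show ?thesis
      unfolding escapes_def
      by (subst sets, subst edges) (simp flip: image_Int[OF inj])
  qed
  ultimately show ?thesis by (simp add: excess_edges_def)
qed


section \<open>Scores\<close>

text \<open>
  The exponent is \<open>1/\<beta>\<close> for the order \<open>\<prec>\<^sub>\<beta>\<close> and \<open>0\<close> for the order that compares
  weights first.  In the former case the score is the power \<open>X powr (1/\<beta>)\<close> of the usual key
  \<open>X = w(e) powr \<beta> * (1 - U\<^sub>e)\<close>; taking this power does not change the order and makes the key
  proportional to the weight.
\<close>

definition score :: "('v \<Rightarrow> real) \<Rightarrow> real \<Rightarrow> ('v set \<Rightarrow> real) \<Rightarrow> 'v set \<Rightarrow> real" where
  "score w \<alpha> u e = edge_weight w e * (1 - u e) powr \<alpha>"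

definition less_score ::
  "('v \<Rightarrow> real) \<Rightarrow> real \<Rightarrow> ('v set \<Rightarrow> real) \<Rightarrow> 'v set \<Rightarrow> 'v set \<Rightarrow> bool" where
  "less_score w \<alpha> u e f \<longleftrightarrow>
     score w \<alpha> u e < score w \<alpha> u f \<or> score w \<alpha> u e = score w \<alpha> u f \<and> 1 - u e < 1 - u f"

lemma edge_order_less_score:
  assumes "simple_graph E" "locally_finite_graph E" "inj_on u E"
  shows "edge_order E (less_score w \<alpha> u)"
proof
  fix e f assume "e \<in> E" "f \<in> E" "e \<noteq> f"
  then have "u e \<noteq> u f" using assms(3) by (auto dest: inj_onD)
  then show "less_score w \<alpha> u e f \<or> less_score w \<alpha> u f e" by (auto simp: less_score_def)
qed (use assms in \<open>auto simp: less_score_def\<close>)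

lemma edge_weight_pos:
  assumes "\<And>v. 0 < w v" "card e = 2"
  shows "0 < edge_weight w e"
  using assms by (auto simp: edge_weight_def card_2_iff)

lemma edge_weight_le: "finite e \<Longrightarrow> v \<in> e \<Longrightarrow> edge_weight w e \<le> w v"
  by (simp add: edge_weight_def)

lemma score_pos:
  assumes "\<And>v. 0 < w v" "card e = 2" "u e < 1"
  shows "0 < score w \<alpha> u e"
  using edge_weight_pos[OF assms(1,2)] assms(3) by (simp add: score_def)

lemma score_le_weight:
  assumes "\<And>v. 0 < w v" "card e = 2" "0 \<le> u e" "u e < 1" "0 \<le> \<alpha>" "v \<in> e"
  shows "score w \<alpha> u e \<le> w v"
proof -
  have "0 < edge_weight w e" by (rule edge_weight_pos) (rule assms)+
  then have "score w \<alpha> u e \<le> edge_weight w e * 1"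
    unfolding score_def using assms(3-5) by (intro mult_left_mono powr_le1) auto
  also have "\<dots> \<le> w v" using assms(2,6) by (simp add: edge_weight_le card_ge_0_finite)
  finally show ?thesis .
qed

lemma less_max_eq_less_score:
  assumes "u e < 1" "u f < 1"
  shows "less_max w u e f \<longleftrightarrow> less_score w 0 u e f"
  using assms by (simp add: less_max_def less_score_def score_def)

lemma less_beta_eq_less_score:
  assumes w: "\<And>v. 0 < w v" and e: "card e = 2" "u e < 1" and f: "card f = 2" "u f < 1"
    and "0 < \<beta>"
  shows "less_beta w \<beta> u e f \<longleftrightarrow> less_score w (1 / \<beta>) u e f"
proof -
  \<comment> \<open>Positive keys and their powers \<open>1/\<beta>\<close> are ordered in the same way.\<close>
  have score: "score w (1 / \<beta>) u g = edge_X w \<beta> u g powr (1 / \<beta>) \<and> 0 < edge_X w \<beta> u g"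
    if "card g = 2" "u g < 1" for g
  proof -
    have "0 < edge_weight w g" by (rule edge_weight_pos[OF w that(1)])
    then show ?thesis
      using that(2) \<open>0 < \<beta>\<close> by (simp add: score_def edge_X_def powr_mult powr_powr)
  qed
  have less: "x powr (1 / \<beta>) < y powr (1 / \<beta>) \<longleftrightarrow> x < y" if "0 < x" "0 < y" for x y :: real
    using that \<open>0 < \<beta>\<close> powr_less_mono2[of "1 / \<beta>" x y] powr_mono2[of "1 / \<beta>" y x]
    by (meson divide_pos_pos less_eq_real_def not_le zero_less_one)
  have "x powr (1 / \<beta>) = y powr (1 / \<beta>) \<longleftrightarrow> x = y" if "0 < x" "0 < y" for x y :: real
    using less[OF that] less[OF that(2,1)] by (auto simp: not_less_iff_gr_or_eq)
  then show ?thesis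
    using score[OF e] score[OF f] less by (simp add: less_beta_def less_score_def)
qed

lemma edge_weight_image:
  assumes "0 < c" "\<And>x. w (\<gamma> x) = c * w x" "finite e" "e \<noteq> {}"
  shows "edge_weight w (\<gamma> ` e) = c * edge_weight w e"
proof -
  have "mono ((*) c)" using assms(1) by (simp add: mono_def)
  then have "c * Min (w ` e) = Min ((*) c ` w ` e)" by (rule mono_Min_commute) (use assms in auto)
  also have "(*) c ` w ` e = w ` \<gamma> ` e" by (simp add: image_image assms(2))
  finally show ?thesis by (simp add: edge_weight_def)
qed


section \<open>Uniform labels\<close>

lemma countable_vertices:
  fixes E :: "'v set set"
  assumes "locally_finite_graph E" "connected_graph E"
  shows "countable (UNIV :: 'v set)"
proof -
  fix x :: 'v
  let ?r = "{(u, v). {u, v} \<in> E}"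
  have "finite {y. (x, y) \<in> ?r ^^ n}" for n
  proof (induction n)
    case (Suc n)
    have "{y. (x, y) \<in> ?r ^^ Suc n} \<subseteq> (\<Union>z\<in>{y. (x, y) \<in> ?r ^^ n}. {y. {z, y} \<in> E})"
      by auto
    moreover have "finite (\<Union>z\<in>{y. (x, y) \<in> ?r ^^ n}. {y. {z, y} \<in> E})"
      using Suc assms(1) by (intro finite_UN_I) (auto simp: locally_finite_graph_def)
    ultimately show ?case by (rule finite_subset)
  qed simp
  then have "countable (\<Union>n. {y. (x, y) \<in> ?r ^^ n})"
    by (intro countable_UN[OF countableI_type] countable_finite)
  moreover have "(\<Union>n. {y. (x, y) \<in> ?r ^^ n}) = UNIV"
    using assms(2) by (auto simp: connected_graph_def rtrancl_power)
  ultimately show "countable (UNIV :: 'v set)" by simp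
qed

lemma countable_finite_sets: "countable (UNIV :: 'v set) \<Longrightarrow> countable {A :: 'v set. finite A}"
  using countable_Collect_finite_subset[of "UNIV :: 'v set"] by simp

lemma countable_edges:
  fixes E :: "'v set set"
  assumes "countable (UNIV :: 'v set)" "simple_graph E"
  shows "countable E"
proof (rule countable_subset[OF _ countable_finite_sets[OF assms(1)]])
  show "E \<subseteq> {A. finite A}"
    using assms(2) by (auto simp: simple_graph_def intro: card_ge_0_finite)
qed

text \<open>
  There are only countably many finite cycles, finite vertex sets and edges, so membership in the set
  of excess edges is a countable combination of comparisons between two edges.
\<close>

lemma pred_excess_edges:
  fixes E :: "'v set set"
  assumes V: "countable (UNIV :: 'v set)" "simple_graph E"
    and R: "\<And>e f. e \<in> E \<Longrightarrow> f \<in> E \<Longrightarrow> Measurable.pred N (\<lambda>u. R u e f)"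
    and e: "e \<in> E"
  shows "Measurable.pred N (\<lambda>u. e \<in> excess_edges E (R u))"
proof -
  have E: "countable E" by (rule countable_edges[OF V])
  have "finite_cycles E \<subseteq> cycle_edges ` lists UNIV" by (auto simp: finite_cycles_def)
  then have cycles: "countable (finite_cycles E)"
    by (rule countable_subset) (intro countable_image countable_lists V(1))
  have "Measurable.pred N (\<lambda>u. e \<notin> C \<or> (\<exists>f\<in>C - {e}. \<not> R u e f))" if "C \<in> finite_cycles E" for C
  proof -
    have "C \<subseteq> E" using that by (auto simp: finite_cycles_def)
    then have "countable (C - {e})" "\<And>f. f \<in> C - {e} \<Longrightarrow> f \<in> E"
      using E countable_subset by blast+
    then have "Measurable.pred N (\<lambda>u. \<exists>f\<in>C - {e}. \<not> R u e f)"
      using R[OF e] by (intro measurable_pred_countable pred_intros_logic) blast+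
    then show ?thesis by (intro pred_intros_logic) auto
  qed
  then have "Measurable.pred N (\<lambda>u. \<forall>C\<in>finite_cycles E. e \<notin> C \<or> (\<exists>f\<in>C - {e}. \<not> R u e f))"
    by (intro measurable_pred_countable cycles)
  moreover have "Measurable.pred N (\<lambda>u. \<forall>A\<in>{A. finite A \<and> e \<inter> A \<noteq> {}}.
      \<exists>f\<in>{f \<in> E. crosses A f}. R u e f)"
    using R[OF e] E countable_finite_sets[OF V(1)]
    by (intro measurable_pred_countable) (auto elim: countable_subset[rotated])
  moreover have "e \<in> excess_edges E (R u) \<longleftrightarrow>
      (\<forall>C\<in>finite_cycles E. e \<notin> C \<or> (\<exists>f\<in>C - {e}. \<not> R u e f)) \<and>
      (\<forall>A\<in>{A. finite A \<and> e \<inter> A \<noteq> {}}. \<exists>f\<in>{f \<in> E. crosses A f}. R u e f)" for u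
    unfolding excess_edges_def free_forest_def escapes_def least_edge_def using e by blast
  ultimately show ?thesis by simp
qed

definition uniform_labels :: "'e set \<Rightarrow> ('e \<Rightarrow> real) measure" where
  "uniform_labels E = PiM E (\<lambda>_. uniform_measure lborel {0..1})"

lemma prob_space_uniform_unit: "prob_space (uniform_measure lborel {0..1::real})"
  by (rule prob_space_uniform_measure) auto

lemma prob_space_uniform_labels: "prob_space (uniform_labels E)"
  unfolding uniform_labels_def by (intro prob_space_PiM prob_space_uniform_unit)

lemma sets_uniform_labels [measurable_cong]: "sets (uniform_labels E) = sets (PiM E (\<lambda>_. borel))"
  unfolding uniform_labels_def by (intro sets_PiM_cong) auto

lemma measurable_label [measurable]: "e \<in> E \<Longrightarrow> (\<lambda>u. u e) \<in> borel_measurable (uniform_labels E)"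
  using measurable_component_singleton[of e E "\<lambda>_. borel"]
    measurable_cong_sets[OF sets_uniform_labels refl] by blast

lemma AE_label_range:
  assumes "countable E"
  shows "AE u in uniform_labels E. \<forall>e\<in>E. 0 \<le> u e \<and> u e < 1"
proof -
  have "AE x in uniform_measure lborel {0..1::real}. 0 \<le> x \<and> x < 1"
    using AE_lborel_singleton[of "1 :: real"] by (intro AE_uniform_measureI) (auto elim: eventually_mono)
  then have "AE u in uniform_labels E. 0 \<le> u e \<and> u e < 1" if "e \<in> E" for e
    unfolding uniform_labels_def by (intro AE_PiM_component that prob_space_uniform_unit)
  then show ?thesis using assms by (subst AE_ball_countable) auto
qed

text \<open>
  Two different labels are independent and uniformly distributed, and the diagonal is a null set of
  the unit square because it meets every vertical line in one point.
\<close>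

lemma AE_labels_distinct_pair:
  assumes "e \<in> E" "f \<in> E" "e \<noteq> f"
  shows "AE u in uniform_labels E. u e \<noteq> u f"
proof -
  let ?\<mu> = "uniform_measure lborel {0..1::real}" and ?N = "uniform_labels E"
  interpret prob_space ?N by (rule prob_space_uniform_labels)
  interpret \<mu>: prob_space ?\<mu> by (rule prob_space_uniform_unit)
  interpret \<mu>\<mu>: pair_sigma_finite ?\<mu> ?\<mu> by unfold_locales
  have rv: "random_variable ?\<mu> (\<lambda>u. u i)" if "i \<in> E" for i
    using measurable_label[OF that] measurable_cong_sets[OF refl, of ?\<mu> borel ?N]
    by (simp only: sets_uniform_measure sets_lborel)
  have marginal: "distr ?N ?\<mu> (\<lambda>u. u i) = ?\<mu>" if "i \<in> E" for i
    unfolding uniform_labels_def by (rule distr_PiM_component) (use that prob_space_uniform_unit in auto)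
  have "distr ?N (PiM E (\<lambda>_. ?\<mu>)) (\<lambda>u. \<lambda>i\<in>E. u i) = distr ?N ?N (\<lambda>u. u)"
    by (rule distr_cong) (auto simp: uniform_labels_def space_PiM PiE_restrict)
  also have "\<dots> = PiM E (\<lambda>_. ?\<mu>)" by (simp add: uniform_labels_def)
  also have "\<dots> = PiM E (\<lambda>i. distr ?N ?\<mu> (\<lambda>u. u i))"
    by (rule PiM_cong) (simp_all only: marginal)
  finally have "indep_vars (\<lambda>_. ?\<mu>) (\<lambda>i u. u i) E"
    using assms rv by (subst indep_vars_iff_distr_eq_PiM') auto
  then have "indep_var (PiM {e} (\<lambda>_. ?\<mu>)) (\<lambda>u. \<lambda>i\<in>{e}. u i) (PiM {f} (\<lambda>_. ?\<mu>)) (\<lambda>u. \<lambda>i\<in>{f}. u i)"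
    by (rule indep_var_restrict) (use assms in auto)
  then have "indep_var ?\<mu> ((\<lambda>x. x e) \<circ> (\<lambda>u. \<lambda>i\<in>{e}. u i)) ?\<mu> ((\<lambda>x. x f) \<circ> (\<lambda>u. \<lambda>i\<in>{f}. u i))"
    by (rule indep_var_compose) (auto intro!: measurable_component_singleton)
  then have "indep_var ?\<mu> (\<lambda>u. u e) ?\<mu> (\<lambda>u. u f)" by (simp add: o_def)
  then have joint: "distr ?N (?\<mu> \<Otimes>\<^sub>M ?\<mu>) (\<lambda>u. (u e, u f)) = ?\<mu> \<Otimes>\<^sub>M ?\<mu>"
    using marginal assms by (simp add: indep_var_distribution_eq)
  have singleton: "AE y in ?\<mu>. x \<noteq> y" for x
    using AE_lborel_singleton[of x] by (intro AE_uniform_measureI) (auto elim: eventually_mono)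
  have "{z \<in> space (?\<mu> \<Otimes>\<^sub>M ?\<mu>). fst z \<noteq> snd z} \<in> sets (?\<mu> \<Otimes>\<^sub>M ?\<mu>)"
  proof (rule borel_measurable_neq)
    have borel: "f \<in> borel_measurable K" if "f \<in> measurable K ?\<mu>" for f and K :: "(real \<times> real) measure"
      using that measurable_cong_sets[OF refl, of ?\<mu> borel K]
      by (simp only: sets_uniform_measure sets_lborel)
    show "fst \<in> borel_measurable (?\<mu> \<Otimes>\<^sub>M ?\<mu>)" by (rule borel) (rule measurable_fst)
    show "snd \<in> borel_measurable (?\<mu> \<Otimes>\<^sub>M ?\<mu>)" by (rule borel) (rule measurable_snd)
  qed
  then have "AE z in ?\<mu> \<Otimes>\<^sub>M ?\<mu>. fst z \<noteq> snd z"
    by (rule \<mu>\<mu>.AE_pair_measure) (rule AE_I2, simp only: fst_conv snd_conv singleton)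
  then have "AE z in distr ?N (?\<mu> \<Otimes>\<^sub>M ?\<mu>) (\<lambda>u. (u e, u f)). fst z \<noteq> snd z"
    unfolding joint .
  moreover have "(\<lambda>u. (u e, u f)) \<in> measurable ?N (?\<mu> \<Otimes>\<^sub>M ?\<mu>)"
    by (intro measurable_Pair rv assms)
  ultimately have "AE u in ?N. fst (u e, u f) \<noteq> snd (u e, u f)" by (rule AE_distrD[rotated])
  then show ?thesis by (simp only: fst_conv snd_conv)
qed

lemma AE_labels_inj:
  assumes "countable E"
  shows "AE u in uniform_labels E. inj_on u E"
proof -
  have "AE u in uniform_labels E. \<forall>e\<in>E. \<forall>f\<in>E. e \<noteq> f \<longrightarrow> u e \<noteq> u f"
    using AE_labels_distinct_pair by (auto simp: AE_ball_countable assms)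
  then show ?thesis by (auto simp: inj_on_def elim!: eventually_mono)
qed

text \<open>
  Almost sure statements about i.i.d. uniform labels can be proved on the product space, where the
  automorphisms of the graph act by permuting coordinates.
\<close>

lemma (in prob_space) AE_iid_uniform_labels:
  assumes "iid_uniform_labels E U" "E \<noteq> {}" "AE u in uniform_labels E. P u"
  shows "AE \<omega> in M. P (\<lambda>e\<in>E. U e \<omega>)"
proof -
  have indep: "indep_vars (\<lambda>_. borel) U E"
    and law: "\<And>e. e \<in> E \<Longrightarrow> distr M borel (U e) = uniform_measure lborel {0..1}"
    using assms(1) by (auto simp: iid_uniform_labels_def)
  have rv: "random_variable borel (U e)" if "e \<in> E" for e
    using indep that by (auto simp: indep_vars_def)
  let ?f = "\<lambda>\<omega>. \<lambda>e\<in>E. U e \<omega>"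
  have f: "?f \<in> measurable M (PiM E (\<lambda>_. borel))" using rv by (intro measurable_restrict)
  have "distr M (PiM E (\<lambda>_. borel)) ?f = uniform_labels E"
    unfolding uniform_labels_def
    using indep rv law assms(2) by (subst (asm) indep_vars_iff_distr_eq_PiM') (auto cong: PiM_cong)
  then have "AE u in distr M (PiM E (\<lambda>_. borel)) ?f. P u" using assms(3) by (simp only:)
  with f show ?thesis by (rule AE_distrD)
qed

lemma distr_uniform_labels_image:
  assumes "inj \<gamma>" "\<And>e. \<gamma> ` e \<in> E \<longleftrightarrow> e \<in> E"
  shows "distr (uniform_labels E) (uniform_labels E) (\<lambda>u. \<lambda>e\<in>E. u (\<gamma> ` e)) = uniform_labels E"
  unfolding uniform_labels_def
  by (rule distr_PiM_reindex[where M = "\<lambda>_. uniform_measure lborel {0..1}"])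
     (use assms prob_space_uniform_unit in \<open>auto intro!: inj_onI simp: inj_image_eq_iff\<close>)


section \<open>The expected score of excess edges\<close>

locale weighted_score = automorphism_subgroup +
  fixes r :: 'a and \<alpha> :: real
  assumes transitive: "acts_transitively \<Gamma>"
    and exponent_nonneg: "0 \<le> \<alpha>"
begin

abbreviation w :: "'a \<Rightarrow> real" where
  "w \<equiv> rel_weight \<Gamma> r"

definition excess_score :: "'a set \<Rightarrow> ('a set \<Rightarrow> real) \<Rightarrow> ennreal" where
  "excess_score e u =
     (if e \<in> excess_edges E (less_score w \<alpha> u) then ennreal (score w \<alpha> u e) else 0)"

definition mean_excess_score :: "'a set \<Rightarrow> ennreal" where
  "mean_excess_score e = (\<integral>\<^sup>+ u. excess_score e u \<partial>uniform_labels E)"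

lemma card_edge: "e \<in> E \<Longrightarrow> card e = 2"
  using simple by (simp add: simple_graph_def)

lemma countable_V: "countable (UNIV :: 'a set)"
  using loc_fin connected by (rule countable_vertices)

lemma countable_E: "countable E"
  using countable_V simple by (rule countable_edges)

lemma measurable_score [measurable]:
  "e \<in> E \<Longrightarrow> (\<lambda>u. score w \<alpha> u e) \<in> borel_measurable (uniform_labels E)"
  unfolding score_def by measurable

lemma measurable_excess_score:
  assumes e: "e \<in> E"
  shows "excess_score e \<in> borel_measurable (uniform_labels E)"
proof -
  let ?N = "uniform_labels E"
  have "Measurable.pred ?N (\<lambda>u. less_score w \<alpha> u f g)" if "f \<in> E" "g \<in> E" for f g
  proof -
    have less: "Measurable.pred ?N (\<lambda>u. score w \<alpha> u f < score w \<alpha> u g)" if "f \<in> E" "g \<in> E" for f g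
      by (intro borel_measurable_pred_less measurable_score that)
    have "Measurable.pred ?N (\<lambda>u. 1 - u f < 1 - u g)"
      by (intro borel_measurable_pred_less borel_measurable_diff borel_measurable_const
          measurable_label that)
    then have "Measurable.pred ?N (\<lambda>u. score w \<alpha> u f < score w \<alpha> u g \<or>
        \<not> score w \<alpha> u g < score w \<alpha> u f \<and> 1 - u f < 1 - u g)"
      by (intro pred_intros_logic less that)
    moreover have "less_score w \<alpha> u f g \<longleftrightarrow> score w \<alpha> u f < score w \<alpha> u g \<or>
        \<not> score w \<alpha> u g < score w \<alpha> u f \<and> 1 - u f < 1 - u g" for u
      unfolding less_score_def by linarith
    ultimately show ?thesis by (simp only:)
  qed
  then have "Measurable.pred ?N (\<lambda>u. e \<in> excess_edges E (less_score w \<alpha> u))"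
    using countable_V simple e by (intro pred_excess_edges)
  then have "{u \<in> space ?N. e \<in> excess_edges E (less_score w \<alpha> u)} \<in> sets ?N"
    unfolding pred_def .
  moreover have "(\<lambda>u. ennreal (score w \<alpha> u e)) \<in> borel_measurable ?N"
    by (rule measurable_compose[OF measurable_score[OF e] measurable_ennreal])
  ultimately show ?thesis
    unfolding excess_score_def by (intro measurable_If borel_measurable_const)
qed

lemma automorphism_image_edge:
  assumes "\<gamma> \<in> \<Gamma>"
  shows "\<gamma> ` e \<in> E \<longleftrightarrow> e \<in> E"
proof -
  have inj: "inj \<gamma>" using bij[OF assms] by (rule bij_is_inj)
  have "card e = 2 \<Longrightarrow> ?thesis"
    using edge_iff[OF assms] by (auto simp: card_2_iff)
  moreover have "card (\<gamma> ` e) = card e" by (rule card_image[OF inj_on_subset[OF inj subset_UNIV]])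
  ultimately show ?thesis using card_edge by metis
qed

text \<open>
  Permuting the labels by \<open>\<gamma>\<close> preserves their law, and replacing \<open>e\<close> by \<open>\<gamma> ` e\<close> has the same
  effect on the order as permuting the labels and multiplying all scores by the constant \<open>w (\<gamma> r)\<close>,
  which leaves the comparisons between edges unchanged.
\<close>

lemma mean_excess_score_image:
  assumes \<gamma>: "\<gamma> \<in> \<Gamma>" and e: "e \<in> E"
  shows "mean_excess_score (\<gamma> ` e) = ennreal (w (\<gamma> r)) * mean_excess_score e"
proof -
  let ?c = "w (\<gamma> r)" and ?T = "\<lambda>u. \<lambda>f\<in>E. u (\<gamma> ` f)" and ?N = "uniform_labels E"
  have c: "0 < ?c" by (rule rel_weight_pos)
  have inj: "inj \<gamma>" using bij[OF \<gamma>] by (rule bij_is_inj)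
  have score: "score w \<alpha> u (\<gamma> ` f) = ?c * score w \<alpha> (?T u) f" if "f \<in> E" for f u
  proof -
    have "finite f" "f \<noteq> {}" using card_edge[OF that] by (auto intro: card_ge_0_finite)
    then have "edge_weight w (\<gamma> ` f) = ?c * edge_weight w f"
      by (intro edge_weight_image c rel_weight_translate[OF \<gamma>])
    then show ?thesis using that by (simp add: score_def)
  qed
  have less: "less_score w \<alpha> u (\<gamma> ` f) (\<gamma> ` g) \<longleftrightarrow> less_score w \<alpha> (?T u) f g"
    if "f \<in> E" "g \<in> E" for f g u
    using that c score[of f u] score[of g u] by (simp add: less_score_def)
  \<comment> \<open>Comparing images under the labels is comparing the edges under the permuted labels.\<close>
  have "\<gamma> ` e \<in> excess_edges E (less_score w \<alpha> u) \<longleftrightarrow> e \<in> excess_edges E (less_score w \<alpha> (?T u))" for u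
  proof -
    have "excess_edges E (\<lambda>f g. less_score w \<alpha> u (\<gamma> ` f) (\<gamma> ` g)) =
        excess_edges E (less_score w \<alpha> (?T u))"
      by (rule excess_edges_cong) (rule less)
    then show ?thesis
      using excess_edges_image[OF bij[OF \<gamma>] automorphism_image_edge[OF \<gamma>]] by simp
  qed
  then have "excess_score (\<gamma> ` e) u = ennreal ?c * excess_score e (?T u)" for u
    using score[OF e, of u] c by (simp add: excess_score_def ennreal_mult')
  then have "mean_excess_score (\<gamma> ` e) = (\<integral>\<^sup>+ u. ennreal ?c * excess_score e (?T u) \<partial>?N)"
    by (simp add: mean_excess_score_def)
  also have "\<dots> = (\<integral>\<^sup>+ u. ennreal ?c * excess_score e u \<partial>distr ?N ?N ?T)"
  proof (rule nn_integral_distr[symmetric])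
    have "?T \<in> measurable ?N (PiM E (\<lambda>_. borel))"
      using automorphism_image_edge[OF \<gamma>] by (intro measurable_restrict measurable_label) simp
    then show "?T \<in> measurable ?N ?N"
      using measurable_cong_sets[OF refl sets_uniform_labels] by blast
    show "(\<lambda>u. ennreal ?c * excess_score e u) \<in> borel_measurable (distr ?N ?N ?T)"
      using measurable_excess_score[OF e] by simp
  qed
  also have "distr ?N ?N ?T = ?N"
    by (rule distr_uniform_labels_image[OF inj automorphism_image_edge[OF \<gamma>]])
  also have "(\<integral>\<^sup>+ u. ennreal ?c * excess_score e u \<partial>?N) = ennreal ?c * mean_excess_score e"
    unfolding mean_excess_score_def by (rule nn_integral_cmult[OF measurable_excess_score[OF e]])
  finally show ?thesis .
qed

lemma AE_good_labels:
  "AE u in uniform_labels E. (\<forall>e\<in>E. 0 \<le> u e \<and> u e < 1) \<and> inj_on u E"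
  using AE_label_range[OF countable_E] AE_labels_inj[OF countable_E] by eventually_elim simp

lemma sum_mean_excess_score_le_boundary:
  assumes K: "finite K"
  shows "(\<Sum>e\<in>{e \<in> E. e \<inter> K \<noteq> {}}. mean_excess_score e) \<le> ennreal (sum w (vertex_boundary E K))"
proof -
  let ?N = "uniform_labels E" and ?D = "{e \<in> E. e \<inter> K \<noteq> {}}" and ?b = "sum w (vertex_boundary E K)"
  interpret prob_space ?N by (rule prob_space_uniform_labels)
  have "(\<Sum>e\<in>?D. mean_excess_score e) = (\<integral>\<^sup>+ u. (\<Sum>e\<in>?D. excess_score e u) \<partial>?N)"
    unfolding mean_excess_score_def
    by (rule nn_integral_sum[symmetric]) (simp add: measurable_excess_score)
  also have "\<dots> \<le> (\<integral>\<^sup>+ u. ennreal ?b \<partial>?N)"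
  proof (rule nn_integral_mono_AE)
    show "AE u in ?N. (\<Sum>e\<in>?D. excess_score e u) \<le> ennreal ?b"
      using AE_good_labels
    proof eventually_elim
      case (elim u)
      interpret edge_order E "less_score w \<alpha> u"
        using simple loc_fin elim by (intro edge_order_less_score) auto
      let ?X = "{e \<in> excess_edges E (less_score w \<alpha> u). e \<inter> K \<noteq> {}}"
      have sub: "?X \<subseteq> ?D" by (auto simp: excess_edges_def free_forest_def)
      have pos: "0 \<le> score w \<alpha> u e" if "e \<in> E" for e
        using score_pos[of w e u \<alpha>] rel_weight_pos card_edge[OF that] elim that by (simp add: less_imp_le)
      have "(\<Sum>e\<in>?D. excess_score e u) = (\<Sum>e\<in>?X. excess_score e u)"
        by (rule sum.mono_neutral_right[OF finite_incident[OF simple loc_fin K] sub]) (auto simp: excess_score_def)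
      also have "\<dots> = (\<Sum>e\<in>?X. ennreal (score w \<alpha> u e))"
        by (rule sum.cong) (auto simp: excess_score_def)
      also have "\<dots> = ennreal (\<Sum>e\<in>?X. score w \<alpha> u e)"
        by (rule sum_ennreal) (use sub pos in blast)
      also have "(\<Sum>e\<in>?X. score w \<alpha> u e) \<le> ?b"
      proof (rule sum_excess_le_boundary[OF K])
        show "score w \<alpha> u e \<le> score w \<alpha> u f" if "less_score w \<alpha> u e f" for e f
          using that by (auto simp: less_score_def)
        show "score w \<alpha> u e \<le> w v" if "e \<in> E" "v \<in> e" for e v
          using that elim rel_weight_pos card_edge exponent_nonneg by (intro score_le_weight) auto
        show "0 \<le> w v" for v using rel_weight_pos by (rule less_imp_le)
      qed
      finally show ?case by (simp add: ennreal_leI)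
    qed
  qed
  also have "\<dots> = ennreal ?b" by (simp add: emeasure_space_1)
  finally show ?thesis .
qed

lemma mean_excess_score_finite:
  assumes "e \<in> E"
  shows "mean_excess_score e < \<infinity>"
proof -
  obtain x y where "e = {x, y}" using simple assms by (rule edge_ends)
  then have "mean_excess_score e \<le> (\<Sum>e\<in>{e \<in> E. e \<inter> {x} \<noteq> {}}. mean_excess_score e)"
    using assms by (intro member_le_sum finite_incident[OF simple loc_fin]) auto
  also have "\<dots> \<le> ennreal (sum w (vertex_boundary E {x}))"
    by (rule sum_mean_excess_score_le_boundary) simp
  also have "\<dots> < \<infinity>" by simp
  finally show ?thesis .
qed

text \<open>
  Every vertex \<open>v\<close> of \<open>K\<close> lies on a translate of \<open>e\<close> whose expected score is that of \<open>e\<close> times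
  \<open>w v / w x\<close>.  Summing over \<open>K\<close> counts every edge at most twice, once for each of its ends; this is
  where the factor \<open>2\<close> comes from.
\<close>

lemma mean_excess_score_mass_bound:
  assumes e: "e \<in> E" "x \<in> e" and K: "finite K"
  shows "enn2real (mean_excess_score e) * sum w K \<le> 2 * w x * sum w (vertex_boundary E K)"
proof -
  let ?D = "{e \<in> E. e \<inter> K \<noteq> {}}" and ?m = mean_excess_score and ?b = "sum w (vertex_boundary E K)"
  define q where "q = enn2real (?m e)"
  have q: "?m e = ennreal q" "0 \<le> q"
    using mean_excess_score_finite[OF e(1)] by (simp_all add: q_def)
  have "\<forall>v. \<exists>\<gamma>\<in>\<Gamma>. \<gamma> x = v" using transitive by (simp add: acts_transitively_def)
  then obtain g where g: "\<And>v. g v \<in> \<Gamma>" "\<And>v. g v x = v" by metis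
  have wx: "0 < w x" "\<And>v. 0 \<le> w v" using rel_weight_pos less_imp_le by metis+
  have copy: "g v ` e \<in> E" "v \<in> g v ` e" "?m (g v ` e) = ennreal (w v / w x * q)" for v
  proof -
    show "g v ` e \<in> E" using automorphism_image_edge[OF g(1)] e(1) by simp
    show "v \<in> g v ` e" using g(2)[of v] e(2) by force
    have "w v = w (g v r) * w x" using rel_weight_translate[OF g(1), of r v x] g(2) by simp
    then have "w (g v r) = w v / w x" using wx by simp
    then show "?m (g v ` e) = ennreal (w v / w x * q)"
      using mean_excess_score_image[OF g(1) e(1), of v] q wx
      by (simp add: ennreal_mult' flip: times_divide_eq_left)
  qed
  have bound: "0 \<le> ?b" using wx(2) by (simp add: sum_nonneg)
  have "ennreal (\<Sum>v\<in>K. w v / w x * q) = (\<Sum>v\<in>K. ?m (g v ` e))"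
    using wx q(2) by (simp add: copy(3) sum_ennreal)
  also have "\<dots> \<le> (\<Sum>v\<in>K. \<Sum>f\<in>?D. if v \<in> f then ?m f else 0)"
  proof (rule sum_mono)
    fix v assume "v \<in> K"
    then have "g v ` e \<in> ?D" using copy(1,2)[of v] by blast
    then have "(if v \<in> g v ` e then ?m (g v ` e) else 0) \<le> (\<Sum>f\<in>?D. if v \<in> f then ?m f else 0)"
      by (rule member_le_sum) (simp_all add: finite_incident[OF simple loc_fin K])
    then show "?m (g v ` e) \<le> (\<Sum>f\<in>?D. if v \<in> f then ?m f else 0)" using copy(2) by simp
  qed
  also have "\<dots> = (\<Sum>f\<in>?D. \<Sum>v\<in>K. if v \<in> f then ?m f else 0)" by (rule sum.swap)
  also have "\<dots> \<le> (\<Sum>f\<in>?D. 2 * ?m f)"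
  proof (rule sum_mono)
    fix f assume "f \<in> ?D"
    then have "card (K \<inter> f) \<le> 2"
      using card_mono[of f "K \<inter> f"] card_edge[of f] card_ge_0_finite[of f] by auto
    then have "of_nat (card (K \<inter> f)) \<le> (2 :: ennreal)" using of_nat_mono[of _ 2] by fastforce
    moreover have "(\<Sum>v\<in>K. if v \<in> f then ?m f else 0) = of_nat (card (K \<inter> f)) * ?m f"
      using K by (simp flip: sum.inter_restrict)
    ultimately show "(\<Sum>v\<in>K. if v \<in> f then ?m f else 0) \<le> 2 * ?m f"
      by (simp add: mult_right_mono)
  qed
  also have "\<dots> = 2 * (\<Sum>f\<in>?D. ?m f)" by (simp add: sum_distrib_left)
  also have "\<dots> \<le> 2 * ennreal ?b"
    by (intro mult_left_mono sum_mean_excess_score_le_boundary[OF K]) simp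
  also have "\<dots> = ennreal (2 * ?b)" by (simp add: ennreal_mult')
  finally have "(\<Sum>v\<in>K. w v / w x * q) \<le> 2 * ?b" using bound by simp
  also have "(\<Sum>v\<in>K. w v / w x * q) = q * sum w K / w x"
    by (simp add: sum_distrib_left sum_divide_distrib mult.commute)
  finally show ?thesis using wx(1) by (simp add: q_def field_simps)
qed

text \<open>
  Amenability provides finite sets for which the boundary term of the mass bound is an arbitrarily
  small multiple of the weight of the set.
\<close>

lemma mean_excess_score_zero:
  assumes amenable: "weighted_amenable E w" and e: "e \<in> E"
  shows "mean_excess_score e = 0"
proof -
  obtain x y where xy: "e = {x, y}" using simple e by (rule edge_ends)
  let ?q = "enn2real (mean_excess_score e)"
  have w: "0 < w v" for v by (rule rel_weight_pos)
  have "?q \<le> \<delta>" if "0 < \<delta>" for \<delta>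
  proof -
    let ?S = "{F :: 'a set. finite F \<and> F \<noteq> {}}"
    have "{x} \<in> ?S" by simp
    then have "(\<lambda>F. sum w (vertex_boundary E F) / sum w F) ` ?S \<noteq> {}" by blast
    moreover have "(INF F\<in>?S. sum w (vertex_boundary E F) / sum w F) < \<delta> / (2 * w x)"
      using amenable that w[of x] by (simp add: weighted_amenable_def)
    ultimately have "\<exists>\<rho>\<in>(\<lambda>F. sum w (vertex_boundary E F) / sum w F) ` ?S. \<rho> < \<delta> / (2 * w x)"
      by (rule cInf_lessD)
    then obtain F where F: "finite F" "F \<noteq> {}"
        "sum w (vertex_boundary E F) / sum w F < \<delta> / (2 * w x)"
      by auto
    have "0 < sum w F" using F(1,2) w by (intro sum_pos) auto
    then have "2 * w x * sum w (vertex_boundary E F) < \<delta> * sum w F"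
      using F(3) w[of x] by (simp add: field_simps)
    then have "?q * sum w F < \<delta> * sum w F"
      using mean_excess_score_mass_bound[OF e _ F(1), of x] xy by simp
    then show ?thesis using \<open>0 < sum w F\<close> by simp
  qed
  then have "?q \<le> 0" by (rule field_le_epsilon[of _ 0, simplified])
  then have "?q = 0" using enn2real_nonneg[of "mean_excess_score e"] by linarith
  then show ?thesis using mean_excess_score_finite[OF e] by (auto simp: enn2real_eq_0_iff)
qed

text \<open>
  For labels below \<open>1\<close> all scores are positive, so an edge whose excess score has
  expectation \<open>0\<close> is almost surely not an excess edge.
\<close>

lemma AE_no_excess_edges:
  assumes "weighted_amenable E w"
  shows "AE u in uniform_labels E. excess_edges E (less_score w \<alpha> u) = {}"
proof -
  have "AE u in uniform_labels E. excess_score e u = 0" if "e \<in> E" for e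
    using mean_excess_score_zero[OF assms that] measurable_excess_score[OF that]
    by (simp add: mean_excess_score_def nn_integral_0_iff_AE)
  then have "AE u in uniform_labels E. \<forall>e\<in>E. excess_score e u = 0"
    by (subst AE_ball_countable[OF countable_E]) blast
  with AE_good_labels show ?thesis
  proof eventually_elim
    case (elim u)
    have "0 < score w \<alpha> u e" if "e \<in> E" for e
      using elim that rel_weight_pos card_edge[OF that] by (intro score_pos) auto
    moreover have "excess_edges E (less_score w \<alpha> u) \<subseteq> E"
      by (auto simp: excess_edges_def free_forest_def)
    moreover have "excess_score e u = 0" if "e \<in> E" for e using elim that by blast
    ultimately show ?case by (force simp: excess_score_def)
  qed
qed

end


section \<open>Equality of the free and the wired forests\<close>

lemma free_eq_wired_if_no_excess:
  assumes "excess_edges E R = {}"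
  shows "free_forest E R = wired_forest E R"
  using free_minus_wired_subset_excess[of E R] assms by (auto simp: wired_forest_def)

theorem proposition3p8:
  fixes E :: "'v set set" and \<Gamma> :: "('v \<Rightarrow> 'v) set" and root :: 'v
    and M :: "'a measure" and U :: "'v set \<Rightarrow> 'a \<Rightarrow> real"
  assumes "simple_graph E" and "locally_finite_graph E" and "connected_graph E"
    and "closed_subgroup_Aut \<Gamma> E" and "nonunimodular \<Gamma> E" and "acts_transitively \<Gamma>"
    and "prob_space M" and "prob_space.iid_uniform_labels M E U"
    and "weighted_amenable E (rel_weight \<Gamma> root)"
  shows "(\<forall>\<beta>>0. AE \<omega> in M.
            F_beta E (rel_weight \<Gamma> root) \<beta> (\<lambda>e. U e \<omega>) =
            W_beta E (rel_weight \<Gamma> root) \<beta> (\<lambda>e. U e \<omega>)) \<and>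
         (AE \<omega> in M.
            FMaxSF E (rel_weight \<Gamma> root) (\<lambda>e. U e \<omega>) =
            WMaxSF E (rel_weight \<Gamma> root) (\<lambda>e. U e \<omega>))"
proof -
  let ?w = "rel_weight \<Gamma> root"
  interpret prob_space M by fact
  interpret \<Gamma>: automorphism_subgroup E \<Gamma> using assms(1-4) by (rule automorphism_subgroupI)
  have w: "0 < ?w v" for v by (rule \<Gamma>.rel_weight_pos)
  have E: "card e = 2" if "e \<in> E" for e using assms(1) that by (simp add: simple_graph_def)
  have forests_eq: "AE \<omega> in M. free_forest E (R (\<lambda>e. U e \<omega>)) = wired_forest E (R (\<lambda>e. U e \<omega>))"
    if "0 \<le> \<alpha>"
      and R: "\<And>u e f. e \<in> E \<Longrightarrow> f \<in> E \<Longrightarrow> u e < 1 \<Longrightarrow> u f < 1 \<Longrightarrow> R u e f \<longleftrightarrow> less_score ?w \<alpha> u e f"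
    for R :: "('v set \<Rightarrow> real) \<Rightarrow> 'v set \<Rightarrow> 'v set \<Rightarrow> bool" and \<alpha>
  proof (cases "E = {}")
    case True
    then show ?thesis by (simp add: free_forest_def wired_forest_def)
  next
    case False
    interpret weighted_score E \<Gamma> root \<alpha> using assms(6) that(1) by unfold_locales
    have "AE u in uniform_labels E. (\<forall>e\<in>E. u e < 1) \<and> excess_edges E (less_score ?w \<alpha> u) = {}"
      using AE_good_labels AE_no_excess_edges[OF assms(9)] by eventually_elim simp
    from AE_iid_uniform_labels[OF assms(8) False this] show ?thesis
    proof eventually_elim
      case (elim \<omega>)
      have "R (\<lambda>e. U e \<omega>) e f \<longleftrightarrow> less_score ?w \<alpha> (\<lambda>e\<in>E. U e \<omega>) e f" if "e \<in> E" "f \<in> E" for e f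
      proof -
        have "R (\<lambda>e. U e \<omega>) e f \<longleftrightarrow> less_score ?w \<alpha> (\<lambda>e. U e \<omega>) e f"
          using elim that by (intro R) auto
        then show ?thesis using that by (simp add: less_score_def score_def)
      qed
      then have "excess_edges E (R (\<lambda>e. U e \<omega>)) = excess_edges E (less_score ?w \<alpha> (\<lambda>e\<in>E. U e \<omega>))"
        by (rule excess_edges_cong)
      with elim show ?case by (intro free_eq_wired_if_no_excess) simp
    qed
  qed
  show ?thesis
  proof (intro conjI allI impI)
    fix \<beta> :: real assume \<beta>: "0 < \<beta>"
    show "AE \<omega> in M. F_beta E ?w \<beta> (\<lambda>e. U e \<omega>) = W_beta E ?w \<beta> (\<lambda>e. U e \<omega>)"
      unfolding F_beta_def W_beta_def
    proof (rule forests_eq)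
      show "0 \<le> 1 / \<beta>" using \<beta> by simp
      fix u :: "'v set \<Rightarrow> real" and e f assume "e \<in> E" "f \<in> E" "u e < 1" "u f < 1"
      then show "less_beta ?w \<beta> u e f \<longleftrightarrow> less_score ?w (1 / \<beta>) u e f"
        by (intro less_beta_eq_less_score w E \<beta>)
    qed
  next
    show "AE \<omega> in M. FMaxSF E ?w (\<lambda>e. U e \<omega>) = WMaxSF E ?w (\<lambda>e. U e \<omega>)"
      unfolding FMaxSF_def WMaxSF_def
      by (rule forests_eq[of 0]) (simp_all add: less_max_eq_less_score)
  qed
qed

end
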